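(* If $CM_X$ is the free Clifford monoid on a set $X$, then the cohomological dimension of $CM_X$ and that of its maximum group image $G=CM_X/\sigma$ agree and are equal to one.
   Context: The free Clifford monoid on a set $X$ is the set $$CM_X=\{(u,A)\in FG_X\times\mathcal{P}(X)\mid c(u)\subseteq A\},$$ where $FG_X$ is the free group on $X$, $\mathcal{P}(X)$ is the set of all subsets of $X$, and $c(u)$ is the content of $u$, i.e. the set of all letters of $X$ represented in the (reduced) word $u$. Multiplication is $(v,B)(u,A)=(vu,B\cup A)$. This is an inverse monoid (a monoid in which every $x$ has a unique $x^{-1}$ with $x=xx^{-1}x$, $x^{-1}=x^{-1}xx^{-1}$). For an inverse monoid $S$ with set of idempotents $E$, the congruence $\sigma$ is defined by: $a\,\sigma\,b$ iff there is $e\in E$ with $ae=be$ (equivalently, there is $f\in E$ with $fa=fb$). The quotient $S/\sigma$ is a group, called the maximum group image of $S$. For a monoid $T$ and a left $\mathbb{Z}T$-module $M$, the Eilenberg-Mac Lane cohomology is $H^n(T,M)=\mathrm{Ext}^n_{\mathbb{Z}T}(\mathbb{Z},M)$, where $\mathbb{Z}T$ is the integral monoid ring and $\mathbb{Z}$ is the trivial left $\mathbb{Z}T$-module. The cohomological dimension $\mathrm{cd}\,T$ is the projective dimension of the trivial left $\mathbb{Z}T$-module $\mathbb{Z}$, i.e. the least $n\ge 0$ such that $H^{m}(T,M)=0$ for all $m>n$ and all left $\mathbb{Z}T$-modules $M$ ($\infty$ if no such $n$ exists).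
   Formalization: The set X is assumed nonempty: for empty X the free Clifford monoid and its maximum group image are trivial and both have cohomological dimension zero, so the claim that they equal one fails there. *)

theory Defs
  imports
    "HOL-Library.Extended_Nat"
    "HOL-Library.Poly_Mapping"
    "HOL-Algebra.Elementary_Groups"
    "HOL-Algebra.Module"
begin

section \<open>Left modules over a (not necessarily commutative) ring\<close>

text \<open>The library locale \<open>module\<close> requires a commutative ring of scalars.  As there, the
  multiplicative fields of the record of the module are ignored.\<close>

locale left_module = R?: ring R + M?: abelian_group M
  for R :: "('r, 'a) ring_scheme" (structure) and M :: "('r, 'm, 'b) module_scheme" (structure) +
  assumes lsmult_closed:
      "\<lbrakk>a \<in> carrier R; x \<in> carrier M\<rbrakk> \<Longrightarrow> a \<odot>\<^bsub>M\<^esub> x \<in> carrier M"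
    and lsmult_l_distr:
      "\<lbrakk>a \<in> carrier R; b \<in> carrier R; x \<in> carrier M\<rbrakk> \<Longrightarrow>
        (a \<oplus> b) \<odot>\<^bsub>M\<^esub> x = a \<odot>\<^bsub>M\<^esub> x \<oplus>\<^bsub>M\<^esub> b \<odot>\<^bsub>M\<^esub> x"
    and lsmult_r_distr:
      "\<lbrakk>a \<in> carrier R; x \<in> carrier M; y \<in> carrier M\<rbrakk> \<Longrightarrow>
        a \<odot>\<^bsub>M\<^esub> (x \<oplus>\<^bsub>M\<^esub> y) = a \<odot>\<^bsub>M\<^esub> x \<oplus>\<^bsub>M\<^esub> a \<odot>\<^bsub>M\<^esub> y"
    and lsmult_assoc:
      "\<lbrakk>a \<in> carrier R; b \<in> carrier R; x \<in> carrier M\<rbrakk> \<Longrightarrow>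
        (a \<otimes> b) \<odot>\<^bsub>M\<^esub> x = a \<odot>\<^bsub>M\<^esub> (b \<odot>\<^bsub>M\<^esub> x)"
    and lsmult_one:
      "x \<in> carrier M \<Longrightarrow> \<one> \<odot>\<^bsub>M\<^esub> x = x"

definition mod_hom ::
  "('r, 'a) ring_scheme \<Rightarrow> ('r, 'm, 'b) module_scheme \<Rightarrow> ('r, 'n, 'c) module_scheme \<Rightarrow> ('m \<Rightarrow> 'n) set"
  where "mod_hom R M N =
    {f \<in> carrier M \<rightarrow> carrier N.
       (\<forall>x\<in>carrier M. \<forall>y\<in>carrier M. f (x \<oplus>\<^bsub>M\<^esub> y) = f x \<oplus>\<^bsub>N\<^esub> f y) \<and>
       (\<forall>a\<in>carrier R. \<forall>x\<in>carrier M. f (a \<odot>\<^bsub>M\<^esub> x) = a \<odot>\<^bsub>N\<^esub> f x)}"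

text \<open>The abelian group of homomorphisms.  Restricting to extensional functions makes
  homomorphisms that agree on the carrier equal.\<close>

definition Hom_group ::
  "('r, 'a) ring_scheme \<Rightarrow> ('r, 'm, 'b) module_scheme \<Rightarrow> ('r, 'n, 'c) module_scheme \<Rightarrow> ('m \<Rightarrow> 'n) monoid"
  where "Hom_group R M N =
    \<lparr>carrier = mod_hom R M N \<inter> extensional (carrier M),
     monoid.mult = (\<lambda>f g. \<lambda>x\<in>carrier M. f x \<oplus>\<^bsub>N\<^esub> g x),
     one = (\<lambda>x\<in>carrier M. \<zero>\<^bsub>N\<^esub>)\<rparr>"

definition free_module :: "('r, 'a) ring_scheme \<Rightarrow> 'b set \<Rightarrow> ('r, 'b \<Rightarrow> 'r) module"
  where "free_module R B =
    \<lparr>carrier = {f \<in> B \<rightarrow>\<^sub>E carrier R. finite {b \<in> B. f b \<noteq> \<zero>\<^bsub>R\<^esub>}},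
     monoid.mult = undefined, one = undefined,
     zero = (\<lambda>b\<in>B. \<zero>\<^bsub>R\<^esub>),
     add = (\<lambda>f g. \<lambda>b\<in>B. f b \<oplus>\<^bsub>R\<^esub> g b),
     smult = (\<lambda>a f. \<lambda>b\<in>B. a \<otimes>\<^bsub>R\<^esub> f b)\<rparr>"

text \<open>Projective means: isomorphic to a direct summand of a free module, that is, a retract of one.
  Bases inside the type of \<open>P\<close> suffice, because a projective module is a retract of the free
  module on its own carrier.\<close>

definition projective_module :: "('r, 'a) ring_scheme \<Rightarrow> ('r, 'p, 'b) module_scheme \<Rightarrow> bool"
  where "projective_module R P \<longleftrightarrow> left_module R P \<and>
    (\<exists>B :: 'p set. \<exists>i \<in> mod_hom R P (free_module R B). \<exists>q \<in> mod_hom R (free_module R B) P.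
       \<forall>x\<in>carrier P. q (i x) = x)"

section \<open>Ext\<close>

text \<open>A projective resolution
  \<open>\<dots> \<rightarrow> P 2 \<rightarrow> P 1 \<rightarrow> P 0 \<rightarrow> N \<rightarrow> 0\<close> with differentials \<open>d n : P (Suc n) \<rightarrow> P n\<close>
  and augmentation \<open>\<epsilon> : P 0 \<rightarrow> N\<close>.\<close>

definition projective_resolution ::
  "('r, 'a) ring_scheme \<Rightarrow> ('r, 'n, 'b) module_scheme \<Rightarrow>
   (nat \<Rightarrow> ('r, 'p) module) \<Rightarrow> (nat \<Rightarrow> 'p \<Rightarrow> 'p) \<Rightarrow> ('p \<Rightarrow> 'n) \<Rightarrow> bool"
  where "projective_resolution R N P d \<epsilon> \<longleftrightarrow>
    (\<forall>n. projective_module R (P n)) \<and>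
    (\<forall>n. d n \<in> mod_hom R (P (Suc n)) (P n)) \<and>
    \<epsilon> \<in> mod_hom R (P 0) N \<and>
    \<epsilon> ` carrier (P 0) = carrier N \<and>
    {x \<in> carrier (P 0). \<epsilon> x = \<zero>\<^bsub>N\<^esub>} = d 0 ` carrier (P 1) \<and>
    (\<forall>n. {x \<in> carrier (P (Suc n)). d n x = \<zero>\<^bsub>P n\<^esub>} = d (Suc n) ` carrier (P (Suc (Suc n))))"

definition Hom_coboundary ::
  "(nat \<Rightarrow> ('r, 'p) module) \<Rightarrow> (nat \<Rightarrow> 'p \<Rightarrow> 'p) \<Rightarrow> nat \<Rightarrow> ('p \<Rightarrow> 'm) \<Rightarrow> 'p \<Rightarrow> 'm"
  where "Hom_coboundary P d n f = (\<lambda>x\<in>carrier (P (Suc n)). f (d n x))"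

definition Hom_cohomology ::
  "('r, 'a) ring_scheme \<Rightarrow> (nat \<Rightarrow> ('r, 'p) module) \<Rightarrow> (nat \<Rightarrow> 'p \<Rightarrow> 'p) \<Rightarrow>
   ('r, 'm, 'c) module_scheme \<Rightarrow> nat \<Rightarrow> ('p \<Rightarrow> 'm) set monoid"
  where "Hom_cohomology R P d M n =
    (Hom_group R (P n) M)
      \<lparr>carrier := kernel (Hom_group R (P n) M) (Hom_group R (P (Suc n)) M) (Hom_coboundary P d n)\<rparr>
    Mod (case n of
           0 \<Rightarrow> {\<one>\<^bsub>Hom_group R (P 0) M\<^esub>}
         | Suc k \<Rightarrow> Hom_coboundary P d k ` carrier (Hom_group R (P k) M))"

text \<open>\<open>Ext TYPE('p) R N M n\<close> is computed from a chosen projective resolution of \<open>N\<close> by modules with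
  elements in \<open>'p\<close>; this is meaningful only if such a resolution exists.\<close>

definition Ext ::
  "'p itself \<Rightarrow> ('r, 'a) ring_scheme \<Rightarrow> ('r, 'n, 'b) module_scheme \<Rightarrow>
   ('r, 'm, 'c) module_scheme \<Rightarrow> nat \<Rightarrow> ('p \<Rightarrow> 'm) set monoid"
  where "Ext _ R N M n =
    (let (P, d, \<epsilon>) = (SOME (P :: nat \<Rightarrow> ('r, 'p) module, d, \<epsilon>). projective_resolution R N P d \<epsilon>)
     in Hom_cohomology R P d M n)"

section \<open>Cohomology of monoids\<close>

definition monoid_ring :: "('a, 'b) monoid_scheme \<Rightarrow> ('a \<Rightarrow>\<^sub>0 int) ring"
  where "monoid_ring T =
    \<lparr>carrier = {r. Poly_Mapping.keys r \<subseteq> carrier T},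
     monoid.mult = (\<lambda>r q. frag_extend (\<lambda>s. frag_extend (\<lambda>t. frag_of (s \<otimes>\<^bsub>T\<^esub> t)) q) r),
     one = frag_of \<one>\<^bsub>T\<^esub>,
     zero = 0,
     add = (+)\<rparr>"

definition trivial_module :: "('a \<Rightarrow>\<^sub>0 int, int) module"
  where "trivial_module =
    \<lparr>carrier = UNIV, monoid.mult = undefined, one = undefined, zero = 0, add = (+),
     smult = (\<lambda>r k. (\<Sum>s\<in>Poly_Mapping.keys r. Poly_Mapping.lookup r s) * k)\<rparr>"

text \<open>The type \<open>'a list \<Rightarrow>\<^sub>0 int\<close> is large enough for projective resolutions of the trivial module:
  it contains the bar resolution, whose \<open>n\<close>-th module is the free abelian group on \<open>T\<^sup>n\<^sup>+\<^sup>1\<close>;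
  see \<open>trivial_module_has_resolution\<close> below.\<close>

definition monoid_cohomology ::
  "('a, 'b) monoid_scheme \<Rightarrow> ('a \<Rightarrow>\<^sub>0 int, 'm, 'c) module_scheme \<Rightarrow> nat \<Rightarrow>
   (('a list \<Rightarrow>\<^sub>0 int) \<Rightarrow> 'm) set monoid"
  where "monoid_cohomology T M n =
    Ext TYPE('a list \<Rightarrow>\<^sub>0 int) (monoid_ring T) trivial_module M n"

text \<open>The coefficient modules range over all modules with elements in the type \<open>'m\<close>, since a definition
  cannot quantify over types.  The infimum of the empty set is \<open>\<infinity>\<close>.\<close>

definition cohomological_dimension :: "'m itself \<Rightarrow> ('a, 'b) monoid_scheme \<Rightarrow> enat"
  where "cohomological_dimension _ T =
    Inf {enat n | n. \<forall>m>n. \<forall>M :: ('a \<Rightarrow>\<^sub>0 int, 'm) module.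
           left_module (monoid_ring T) M \<longrightarrow> trivial_group (monoid_cohomology T M m)}"

section \<open>The maximum group image\<close>

definition idempotents :: "('a, 'b) monoid_scheme \<Rightarrow> 'a set"
  where "idempotents S = {e \<in> carrier S. e \<otimes>\<^bsub>S\<^esub> e = e}"

definition sigma_rel :: "('a, 'b) monoid_scheme \<Rightarrow> ('a \<times> 'a) set"
  where "sigma_rel S =
    {(a, b) \<in> carrier S \<times> carrier S. \<exists>e\<in>idempotents S. a \<otimes>\<^bsub>S\<^esub> e = b \<otimes>\<^bsub>S\<^esub> e}"

definition quotient_monoid :: "('a, 'b) monoid_scheme \<Rightarrow> ('a \<times> 'a) set \<Rightarrow> 'a set monoid"
  where "quotient_monoid S \<rho> =
    \<lparr>carrier = carrier S // \<rho>,
     monoid.mult = (\<lambda>U V. \<Union>u\<in>U. \<Union>v\<in>V. \<rho> `` {u \<otimes>\<^bsub>S\<^esub> v}),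
     one = \<rho> `` {\<one>\<^bsub>S\<^esub>}\<rparr>"

definition max_group_image :: "('a, 'b) monoid_scheme \<Rightarrow> 'a set monoid"
  where "max_group_image S = quotient_monoid S (sigma_rel S)"

section \<open>Free groups and free Clifford monoids\<close>

text \<open>A letter \<open>(x, True)\<close> stands for \<open>x\<close>, and \<open>(x, False)\<close> for its inverse.\<close>

type_synonym 'x word = "('x \<times> bool) list"

definition letter_inv :: "'x \<times> bool \<Rightarrow> 'x \<times> bool"
  where "letter_inv a = (fst a, \<not> snd a)"

fun cons_cancel :: "'x \<times> bool \<Rightarrow> 'x word \<Rightarrow> 'x word"
  where
    "cons_cancel a [] = [a]"
  | "cons_cancel a (b # w) = (if b = letter_inv a then w else a # b # w)"

definition reduce_word :: "'x word \<Rightarrow> 'x word"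
  where "reduce_word w = foldr cons_cancel w []"

definition reduced_word :: "'x word \<Rightarrow> bool"
  where "reduced_word w \<longleftrightarrow> successively (\<lambda>a b. b \<noteq> letter_inv a) w"

definition content :: "'x word \<Rightarrow> 'x set"
  where "content w = fst ` set w"

definition free_group :: "'x set \<Rightarrow> 'x word monoid"
  where "free_group X =
    \<lparr>carrier = {w. reduced_word w \<and> content w \<subseteq> X},
     monoid.mult = (\<lambda>v u. reduce_word (v @ u)),
     one = []\<rparr>"

definition free_Clifford_monoid :: "'x set \<Rightarrow> ('x word \<times> 'x set) monoid"
  where "free_Clifford_monoid X =
    \<lparr>carrier = {(u, A) \<in> carrier (free_group X) \<times> Pow X. content u \<subseteq> A},
     monoid.mult = (\<lambda>(v, B) (u, A). (v \<otimes>\<^bsub>free_group X\<^esub> u, B \<union> A)),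
     one = (\<one>\<^bsub>free_group X\<^esub>, {})\<rparr>"

section \<open>Existence of the resolution used for monoid cohomology\<close>

text \<open>The bar resolution with the trivial module in degree \<open>-1\<close> is treated uniformly as the free
  abelian group on lists, graded by length.\<close>

context
  fixes T :: "('a, 'b) monoid_scheme" (structure)
  assumes T: "monoid T"
begin

interpretation T: monoid T by (rule T)

private definition act :: "'a \<Rightarrow> ('a list \<Rightarrow>\<^sub>0 int) \<Rightarrow> ('a list \<Rightarrow>\<^sub>0 int)"
  where "act s = frag_extend (\<lambda>l. frag_of (case l of [] \<Rightarrow> [] | t # m \<Rightarrow> (s \<otimes> t) # m))"

private definition hty :: "('a list \<Rightarrow>\<^sub>0 int) \<Rightarrow> ('a list \<Rightarrow>\<^sub>0 int)"
  where "hty = frag_extend (\<lambda>l. frag_of (\<one> # l))"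

private primrec bd :: "'a list \<Rightarrow> ('a list \<Rightarrow>\<^sub>0 int)"
  where
    "bd [] = 0"
  | "bd (t # l) = act t (frag_of l - hty (bd l))"

private definition D :: "('a list \<Rightarrow>\<^sub>0 int) \<Rightarrow> ('a list \<Rightarrow>\<^sub>0 int)"
  where "D = frag_extend bd"

private definition L :: "nat \<Rightarrow> 'a list set"
  where "L n = {l. set l \<subseteq> carrier T \<and> length l = n}"

private definition C :: "nat \<Rightarrow> ('a list \<Rightarrow>\<^sub>0 int) set"
  where "C n = {c. Poly_Mapping.keys c \<subseteq> L n}"

private definition ract :: "('a \<Rightarrow>\<^sub>0 int) \<Rightarrow> ('a list \<Rightarrow>\<^sub>0 int) \<Rightarrow> ('a list \<Rightarrow>\<^sub>0 int)"
  where "ract r c = frag_extend (\<lambda>s. act s c) r"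

private definition bar :: "nat \<Rightarrow> ('a \<Rightarrow>\<^sub>0 int, 'a list \<Rightarrow>\<^sub>0 int) module"
  where "bar n = \<lparr>carrier = C (Suc n), monoid.mult = undefined, one = undefined,
           zero = 0, add = (+), smult = ract\<rparr>"

private lemma C_induct [consumes 1, case_names zero one diff]:
  assumes "c \<in> C n" "P 0" "\<And>l. l \<in> L n \<Longrightarrow> P (frag_of l)"
    "\<And>a b. \<lbrakk>a \<in> C n; b \<in> C n; P a; P b\<rbrakk> \<Longrightarrow> P (a - b)"
  shows "P c"
proof -
  have "P c \<and> c \<in> C n"
    using assms(1) unfolding C_def mem_Collect_eq
  proof (induction c rule: frag_induction)
    case (diff a b)
    then show ?case
      using assms(4)[of a b] keys_diff[of a b] unfolding C_def by auto
  qed (use assms in auto)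
  then show ?thesis by simp
qed

private lemma C_0: "0 \<in> C n" by (simp add: C_def)
private lemma C_of: "l \<in> L n \<Longrightarrow> frag_of l \<in> C n" by (simp add: C_def)
private lemma C_add: "a \<in> C n \<Longrightarrow> b \<in> C n \<Longrightarrow> a + b \<in> C n"
  using Poly_Mapping.keys_add[of a b] by (auto simp: C_def)
private lemma C_diff: "a \<in> C n \<Longrightarrow> b \<in> C n \<Longrightarrow> a - b \<in> C n"
  using keys_diff[of a b] by (auto simp: C_def)
private lemma C_extend:
  assumes "Poly_Mapping.keys c \<subseteq> S" "\<And>l. l \<in> S \<Longrightarrow> f l \<in> C n"
  shows "frag_extend f c \<in> C n"
  using assms keys_frag_extend[of f c] unfolding C_def by fastforce

private lemma L_Cons: "t # l \<in> L (Suc n) \<longleftrightarrow> t \<in> carrier T \<and> l \<in> L n"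
  by (auto simp: L_def)

private lemma L_SucE:
  assumes "m \<in> L (Suc n)" obtains t l where "m = t # l" "t \<in> carrier T" "l \<in> L n"
  using assms by (cases m) (auto simp: L_def)

private lemma act_L: "s \<in> carrier T \<Longrightarrow> l \<in> L n \<Longrightarrow>
    (case l of [] \<Rightarrow> [] | t # m \<Rightarrow> (s \<otimes> t) # m) \<in> L n"
  by (auto simp: L_def split: list.splits)

private lemma act_C: "s \<in> carrier T \<Longrightarrow> c \<in> C n \<Longrightarrow> act s c \<in> C n"
  unfolding act_def by (rule C_extend[of _ "L n"]) (auto simp: C_def act_L)

private lemma hty_C: "c \<in> C n \<Longrightarrow> hty c \<in> C (Suc n)"
  unfolding hty_def by (rule C_extend[of _ "L n"]) (auto simp: C_def L_Cons)

private lemma act_lin: "act s 0 = 0" "act s (a + b) = act s a + act s b"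
    "act s (a - b) = act s a - act s b"
  by (simp_all add: act_def frag_extend_add frag_extend_diff)

private lemma hty_lin: "hty 0 = 0" "hty (a + b) = hty a + hty b" "hty (a - b) = hty a - hty b"
  by (simp_all add: hty_def frag_extend_add frag_extend_diff)

private lemma D_lin: "D 0 = 0" "D (a + b) = D a + D b" "D (a - b) = D a - D b"
  by (simp_all add: D_def frag_extend_add frag_extend_diff)

private lemma act_act: "c \<in> C n \<Longrightarrow> s \<in> carrier T \<Longrightarrow> t \<in> carrier T \<Longrightarrow>
    act s (act t c) = act (s \<otimes> t) c"
  by (induction c rule: C_induct)
    (auto simp: act_lin, auto simp: act_def L_def T.m_assoc split: list.splits)

private lemma act_one: "c \<in> C n \<Longrightarrow> act \<one> c = c"
  by (induction c rule: C_induct)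
    (auto simp: act_lin, auto simp: act_def L_def split: list.splits)

private lemma bd_C: "l \<in> L (Suc n) \<Longrightarrow> bd l \<in> C n"
proof (induction n arbitrary: l)
  case 0
  then obtain t where "l = [t]" "t \<in> carrier T" by (auto simp: L_def length_Suc_conv)
  then show ?case by (auto simp: hty_lin act_def C_def L_def)
next
  case (Suc n)
  from Suc.prems obtain t l' where l': "l = t # l'" "t \<in> carrier T" "l' \<in> L (Suc n)"
    by (rule L_SucE)
  then show ?case using hty_C[OF Suc.IH] by (simp add: act_C C_diff C_of)
qed

private lemma D_C: "c \<in> C (Suc n) \<Longrightarrow> D c \<in> C n"
  unfolding D_def by (rule C_extend[of _ "L (Suc n)"]) (auto simp: C_def[of "Suc n"] bd_C)

private lemma bd_hty_C: "l \<in> L n \<Longrightarrow> frag_of l - hty (bd l) \<in> C n"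
proof (cases n)
  case (Suc m)
  then show "l \<in> L n \<Longrightarrow> ?thesis" using hty_C[OF bd_C, of l m] by (simp add: C_diff C_of)
qed (simp add: L_def C_def hty_lin)

private lemma D_act: "c \<in> C n \<Longrightarrow> s \<in> carrier T \<Longrightarrow> D (act s c) = act s (D c)"
proof (induction c rule: C_induct)
  case (one l)
  then show ?case
  proof (cases l)
    case (Cons t m)
    then have "t \<in> carrier T" "m \<in> L (n - 1)" using one by (auto simp: L_def)
    with Cons one show ?thesis
      by (simp add: D_def act_act[OF bd_hty_C]) (simp add: act_def)
  qed (simp add: act_def D_def)
qed (auto simp: act_lin D_lin)

private lemma D_hty: "c \<in> C n \<Longrightarrow> D (hty c) = c - hty (D c)"
proof (induction c rule: C_induct)
  case (one l)
  then show ?case using act_one[OF bd_hty_C] by (simp add: D_def) (simp add: hty_def)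
qed (auto simp: hty_lin D_lin)

private lemma D_bd: "l \<in> L n \<Longrightarrow> D (bd l) = 0"
proof (induction l arbitrary: n)
  case (Cons t l)
  then have *: "t \<in> carrier T" "l \<in> L (n - 1)" by (auto simp: L_def)
  have "D (bd (t # l)) = act t (D (frag_of l - hty (bd l)))"
    using * by (simp add: D_act[OF bd_hty_C])
  also have "D (frag_of l - hty (bd l)) = bd l - D (hty (bd l))"
    by (simp add: D_lin) (simp add: D_def)
  also have "D (hty (bd l)) = bd l - hty (D (bd l))"
  proof (cases l)
    case Nil then show ?thesis by (simp add: hty_lin D_lin)
  next
    case (Cons u k)
    then show ?thesis using * by (intro D_hty[of _ "n - 2"] bd_C) (auto simp: L_def)
  qed
  finally show ?case by (simp add: Cons.IH[OF *(2)] hty_lin act_lin)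
qed (simp add: D_lin)

private lemma D_D: "c \<in> C n \<Longrightarrow> D (D c) = 0"
  by (induction c rule: C_induct) (auto simp: D_lin, simp add: D_def[of ] D_bd[unfolded D_def])

private lemma exact: "{c \<in> C (Suc n). D c = 0} = D ` C (Suc (Suc n))"
proof (intro subset_antisym subsetI)
  fix c assume "c \<in> {c \<in> C (Suc n). D c = 0}"
  then have "c = D (hty c)" "hty c \<in> C (Suc (Suc n))"
    using D_hty[of c "Suc n"] hty_C[of c "Suc n"] by (auto simp: hty_lin)
  then show "c \<in> D ` C (Suc (Suc n))" by blast
qed (auto simp: D_C D_D)

private lemma ract_lin: "ract r (a + b) = ract r a + ract r b" "ract r (a - b) = ract r a - ract r b"
  "ract r 0 = 0" "ract (r + q) a = ract r a + ract q a" "ract (r - q) a = ract r a - ract q a"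
  "ract 0 a = 0" "ract (frag_of s) a = act s a"
proof -
  show "ract r (a + b) = ract r a + ract r b"
    using subset_UNIV[of "Poly_Mapping.keys r"]
    by (induction r rule: frag_induction) (auto simp: ract_def act_lin frag_extend_diff)
  show "ract r (a - b) = ract r a - ract r b"
    using subset_UNIV[of "Poly_Mapping.keys r"]
    by (induction r rule: frag_induction) (auto simp: ract_def act_lin frag_extend_diff)
qed (auto simp: ract_def act_lin frag_extend_add frag_extend_diff frag_extend_eq_0)

private lemma ract_C: "Poly_Mapping.keys r \<subseteq> carrier T \<Longrightarrow> c \<in> C n \<Longrightarrow> ract r c \<in> C n"
  unfolding ract_def by (rule C_extend) (auto simp: act_C)

lemma monoid_ring_mult_lin:
  "(a + b) \<otimes>\<^bsub>monoid_ring T\<^esub> c = a \<otimes>\<^bsub>monoid_ring T\<^esub> c + b \<otimes>\<^bsub>monoid_ring T\<^esub> c"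
  "(a - b) \<otimes>\<^bsub>monoid_ring T\<^esub> c = a \<otimes>\<^bsub>monoid_ring T\<^esub> c - b \<otimes>\<^bsub>monoid_ring T\<^esub> c"
  "c \<otimes>\<^bsub>monoid_ring T\<^esub> (a + b) = c \<otimes>\<^bsub>monoid_ring T\<^esub> a + c \<otimes>\<^bsub>monoid_ring T\<^esub> b"
  "c \<otimes>\<^bsub>monoid_ring T\<^esub> (a - b) = c \<otimes>\<^bsub>monoid_ring T\<^esub> a - c \<otimes>\<^bsub>monoid_ring T\<^esub> b"
  "0 \<otimes>\<^bsub>monoid_ring T\<^esub> c = 0" "c \<otimes>\<^bsub>monoid_ring T\<^esub> 0 = 0"
  "frag_of s \<otimes>\<^bsub>monoid_ring T\<^esub> frag_of t = frag_of (s \<otimes> t)"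
proof -
  show "c \<otimes>\<^bsub>monoid_ring T\<^esub> (a + b) = c \<otimes>\<^bsub>monoid_ring T\<^esub> a + c \<otimes>\<^bsub>monoid_ring T\<^esub> b"
    using subset_UNIV[of "Poly_Mapping.keys c"]
    by (induction c rule: frag_induction) (auto simp: monoid_ring_def frag_extend_diff frag_extend_add)
  show "c \<otimes>\<^bsub>monoid_ring T\<^esub> (a - b) = c \<otimes>\<^bsub>monoid_ring T\<^esub> a - c \<otimes>\<^bsub>monoid_ring T\<^esub> b"
    using subset_UNIV[of "Poly_Mapping.keys c"]
    by (induction c rule: frag_induction) (auto simp: monoid_ring_def frag_extend_diff)
qed (auto simp: monoid_ring_def frag_extend_add frag_extend_diff frag_extend_eq_0)

lemma ring_monoid_ring: "ring (monoid_ring T)"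
proof -
  let ?R = "monoid_ring T"
  have [simp]: "a \<oplus>\<^bsub>?R\<^esub> b = a + b" "\<zero>\<^bsub>?R\<^esub> = 0" "\<one>\<^bsub>?R\<^esub> = frag_of \<one>"
    "a \<in> carrier ?R \<longleftrightarrow> Poly_Mapping.keys a \<subseteq> carrier T" for a b
    by (auto simp: monoid_ring_def)
  have cl: "Poly_Mapping.keys (a \<otimes>\<^bsub>?R\<^esub> b) \<subseteq> carrier T"
    if "Poly_Mapping.keys a \<subseteq> carrier T" "Poly_Mapping.keys b \<subseteq> carrier T" for a b
    using that(1)
  proof (induction a rule: frag_induction)
    case (one s)
    show ?case using that(2)
    proof (induction b rule: frag_induction)
      case (diff a b) then show ?case
        using keys_diff[of "frag_of s \<otimes>\<^bsub>?R\<^esub> a" "frag_of s \<otimes>\<^bsub>?R\<^esub> b"]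
        by (auto simp: monoid_ring_mult_lin)
    qed (use one in \<open>auto simp: monoid_ring_mult_lin\<close>)
  next
    case (diff c d) then show ?case
      using keys_diff[of "c \<otimes>\<^bsub>?R\<^esub> b" "d \<otimes>\<^bsub>?R\<^esub> b"] by (auto simp: monoid_ring_mult_lin)
  qed (auto simp: monoid_ring_mult_lin)
  have assoc: "a \<otimes>\<^bsub>?R\<^esub> b \<otimes>\<^bsub>?R\<^esub> c = a \<otimes>\<^bsub>?R\<^esub> (b \<otimes>\<^bsub>?R\<^esub> c)"
    if "Poly_Mapping.keys a \<subseteq> carrier T" "Poly_Mapping.keys b \<subseteq> carrier T"
      "Poly_Mapping.keys c \<subseteq> carrier T" for a b c
    using that(1)
  proof (induction a rule: frag_induction)
    case (one s)
    show ?case using that(2)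
    proof (induction b rule: frag_induction)
      case one': (one t)
      show ?case using that(3)
        by (induction c rule: frag_induction)
          (use one one' in \<open>auto simp: monoid_ring_mult_lin T.m_assoc\<close>)
    qed (auto simp: monoid_ring_mult_lin)
  qed (auto simp: monoid_ring_mult_lin)
  have one: "frag_of \<one> \<otimes>\<^bsub>?R\<^esub> a = a" "a \<otimes>\<^bsub>?R\<^esub> frag_of \<one> = a"
    if "Poly_Mapping.keys a \<subseteq> carrier T" for a
    using that by (induction a rule: frag_induction) (auto simp: monoid_ring_mult_lin)
  show ?thesis
  proof (rule ringI)
    show "abelian_group ?R"
    proof (rule abelian_groupI)
      fix x assume "x \<in> carrier ?R"
      then show "\<exists>y\<in>carrier ?R. y \<oplus>\<^bsub>?R\<^esub> x = \<zero>\<^bsub>?R\<^esub>" by (intro bexI[of _ "- x"]) auto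
    next
      fix x y assume "x \<in> carrier ?R" "y \<in> carrier ?R"
      then show "x \<oplus>\<^bsub>?R\<^esub> y \<in> carrier ?R" using Poly_Mapping.keys_add[of x y] by auto
    qed auto
    show "Group.monoid ?R" by (rule monoidI) (auto simp: cl[THEN subsetD] assoc one)
  qed (auto simp: monoid_ring_mult_lin)
qed

private lemma ract_mult:
  assumes "Poly_Mapping.keys r \<subseteq> carrier T" "Poly_Mapping.keys q \<subseteq> carrier T" "c \<in> C n"
  shows "ract (r \<otimes>\<^bsub>monoid_ring T\<^esub> q) c = ract r (ract q c)"
  using assms(1)
proof (induction r rule: frag_induction)
  case (one s)
  show ?case using assms(2)
    by (induction q rule: frag_induction)
      (use one assms(3) in \<open>auto simp: monoid_ring_mult_lin ract_lin act_act\<close>)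
qed (auto simp: monoid_ring_mult_lin ract_lin)

private lemma bar_module: "left_module (monoid_ring T) (bar n)"
proof -
  interpret ring "monoid_ring T" by (rule ring_monoid_ring)
  have "abelian_group (bar n)"
  proof (rule abelian_groupI)
    fix x assume "x \<in> carrier (bar n)"
    then show "\<exists>y\<in>carrier (bar n). y \<oplus>\<^bsub>bar n\<^esub> x = \<zero>\<^bsub>bar n\<^esub>"
      by (intro bexI[of _ "- x"]) (auto simp: bar_def C_def)
  qed (auto simp: bar_def C_0 C_add)
  then interpret M: abelian_group "bar n" .
  show ?thesis
    by unfold_locales
      (auto simp: bar_def ract_C ract_lin ract_mult act_one,
       auto simp: monoid_ring_def ract_C ract_lin act_one ract_mult[unfolded monoid_ring_def, simplified])
qed

private lemma D_ract: "Poly_Mapping.keys r \<subseteq> carrier T \<Longrightarrow> c \<in> C n \<Longrightarrow> D (ract r c) = ract r (D c)"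
  by (induction r rule: frag_induction) (auto simp: ract_lin D_lin D_act)

private lemma keys_monoid_ring: "r \<in> carrier (monoid_ring T) \<longleftrightarrow> Poly_Mapping.keys r \<subseteq> carrier T"
  by (simp add: monoid_ring_def)

subsection \<open>Freeness of the bar modules\<close>

private definition base :: "nat \<Rightarrow> ('a list \<Rightarrow>\<^sub>0 int) set"
  where "base n = (\<lambda>l. frag_of (\<one> # l)) ` L n"

private definition comp :: "'a list \<Rightarrow> ('a list \<Rightarrow>\<^sub>0 int) \<Rightarrow> ('a \<Rightarrow>\<^sub>0 int)"
  where "comp l = frag_extend (\<lambda>m. if tl m = l then frag_of (hd m) else 0)"

private definition emb :: "nat \<Rightarrow> ('a list \<Rightarrow>\<^sub>0 int) \<Rightarrow> ('a list \<Rightarrow>\<^sub>0 int) \<Rightarrow> ('a \<Rightarrow>\<^sub>0 int)"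
  where "emb n c = (\<lambda>b\<in>base n. comp (tl (the_elem (Poly_Mapping.keys b))) c)"

private definition prj :: "nat \<Rightarrow> (('a list \<Rightarrow>\<^sub>0 int) \<Rightarrow> ('a \<Rightarrow>\<^sub>0 int)) \<Rightarrow> ('a list \<Rightarrow>\<^sub>0 int)"
  where "prj n f = (\<Sum>b\<in>{b \<in> base n. f b \<noteq> 0}. ract (f b) b)"

private lemma comp_lin: "comp l 0 = 0" "comp l (a + b) = comp l a + comp l b"
  "comp l (a - b) = comp l a - comp l b"
  by (simp_all add: comp_def frag_extend_add frag_extend_diff)

private lemma comp_keys: "c \<in> C (Suc n) \<Longrightarrow> Poly_Mapping.keys (comp l c) \<subseteq> carrier T"
proof (induction c rule: C_induct)
  case (diff a b)
  then show ?case using keys_diff[of "comp l a" "comp l b"] by (auto simp: comp_lin)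
qed (auto simp: comp_lin, auto simp: comp_def elim!: L_SucE split: if_splits)

private lemma comp_act: "c \<in> C (Suc n) \<Longrightarrow> s \<in> carrier T \<Longrightarrow>
    comp l (act s c) = frag_of s \<otimes>\<^bsub>monoid_ring T\<^esub> comp l c"
proof (induction c rule: C_induct)
  case (one m)
  then show ?case
    by (auto elim!: L_SucE simp: comp_def act_def monoid_ring_mult_lin)
qed (auto simp: act_lin comp_lin monoid_ring_mult_lin)

private lemma comp_ract: "Poly_Mapping.keys r \<subseteq> carrier T \<Longrightarrow> c \<in> C (Suc n) \<Longrightarrow>
    comp l (ract r c) = r \<otimes>\<^bsub>monoid_ring T\<^esub> comp l c"
  by (induction r rule: frag_induction) (auto simp: ract_lin comp_lin comp_act monoid_ring_mult_lin)

private lemma prj_superset: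
  assumes "finite S" "{b \<in> base n. f b \<noteq> 0} \<subseteq> S" "S \<subseteq> base n"
  shows "prj n f = (\<Sum>b\<in>S. ract (f b) b)"
  unfolding prj_def using assms by (intro sum.mono_neutral_left) (auto simp: ract_lin)

private lemma base_C: "b \<in> base n \<Longrightarrow> b \<in> C (Suc n)"
  by (auto simp: base_def L_Cons intro!: C_of)

private lemma sum_C: "(\<And>b. b \<in> S \<Longrightarrow> f b \<in> C n) \<Longrightarrow> sum f S \<in> C n"
  by (induction S rule: infinite_finite_induct) (auto simp: C_0 C_add)

private lemma emb_fin: "finite {b \<in> base n. emb n c b \<noteq> 0}"
proof (rule finite_subset)
  show "{b \<in> base n. emb n c b \<noteq> 0} \<subseteq> (\<lambda>m. frag_of (\<one> # tl m)) ` Poly_Mapping.keys c"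
  proof
    fix b assume "b \<in> {b \<in> base n. emb n c b \<noteq> 0}"
    then obtain l where l: "b = frag_of (\<one> # l)" "comp l c \<noteq> 0"
      by (auto simp: base_def emb_def split: if_splits)
    then obtain m where "m \<in> Poly_Mapping.keys c" "tl m = l"
      using frag_extend_eq_0[of c "\<lambda>m. if tl m = l then frag_of (hd m) else 0"]
      unfolding comp_def by fastforce
    with l show "b \<in> (\<lambda>m. frag_of (\<one> # tl m)) ` Poly_Mapping.keys c" by blast
  qed
qed simp

private abbreviation "FM n \<equiv> free_module (monoid_ring T) (base n)"

private lemma emb_hom: "emb n \<in> mod_hom (monoid_ring T) (bar n) (FM n)"
  unfolding mod_hom_def
proof (intro CollectI conjI ballI Pi_I)
  fix c assume c: "c \<in> carrier (bar n)"
  then show "emb n c \<in> carrier (FM n)"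
    using emb_fin[of n c] comp_keys[of c n]
    by (auto simp: free_module_def bar_def emb_def monoid_ring_def)
  fix r assume "r \<in> carrier (monoid_ring T)"
  with c show "emb n (r \<odot>\<^bsub>bar n\<^esub> c) = r \<odot>\<^bsub>FM n\<^esub> emb n c"
    by (auto simp: free_module_def bar_def emb_def keys_monoid_ring comp_ract intro!: restrict_ext)
next
  fix c c' assume "c \<in> carrier (bar n)" "c' \<in> carrier (bar n)"
  show "emb n (c \<oplus>\<^bsub>bar n\<^esub> c') = emb n c \<oplus>\<^bsub>FM n\<^esub> emb n c'"
    by (auto simp: free_module_def bar_def emb_def comp_lin monoid_ring_def intro!: restrict_ext)
qed

private lemma prj_add:
  assumes "finite {b \<in> base n. f b \<noteq> 0}" "finite {b \<in> base n. g b \<noteq> 0}"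
    "\<And>b. b \<in> base n \<Longrightarrow> k b = f b + g b"
  shows "prj n k = prj n f + prj n g"
proof -
  let ?S = "{b \<in> base n. f b \<noteq> 0} \<union> {b \<in> base n. g b \<noteq> 0}"
  have "prj n k = (\<Sum>b\<in>?S. ract (k b) b)" "prj n f = (\<Sum>b\<in>?S. ract (f b) b)"
    "prj n g = (\<Sum>b\<in>?S. ract (g b) b)"
    using assms by (auto intro!: prj_superset)
  moreover have "(\<Sum>b\<in>?S. ract (k b) b) = (\<Sum>b\<in>?S. ract (f b) b + ract (g b) b)"
    using assms(3) by (intro sum.cong) (auto simp: ract_lin)
  ultimately show ?thesis by (simp add: sum.distrib)
qed

private lemma prj_hom: "prj n \<in> mod_hom (monoid_ring T) (FM n) (bar n)"
  unfolding mod_hom_def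
proof (intro CollectI conjI ballI Pi_I)
  fix f assume f: "f \<in> carrier (FM n)"
  have k: "b \<in> base n \<Longrightarrow> Poly_Mapping.keys (f b) \<subseteq> carrier T" for b
    using f by (auto simp: free_module_def monoid_ring_def)
  have fin: "finite {b \<in> base n. f b \<noteq> 0}"
    using f by (simp add: free_module_def monoid_ring_def)
  from k show "prj n f \<in> carrier (bar n)"
    by (auto simp: bar_def prj_def intro!: sum_C ract_C dest: base_C)
  fix r assume r: "r \<in> carrier (monoid_ring T)"
  let ?S = "{b \<in> base n. f b \<noteq> 0}"
  have "prj n (r \<odot>\<^bsub>FM n\<^esub> f) = (\<Sum>b\<in>?S. ract (r \<otimes>\<^bsub>monoid_ring T\<^esub> f b) b)"
    using fin by (subst prj_superset[of ?S])
      (auto simp: free_module_def monoid_ring_mult_lin intro!: sum.cong)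
  also have "\<dots> = (\<Sum>b\<in>?S. ract r (ract (f b) b))"
    using r k by (intro sum.cong refl ract_mult) (auto simp: keys_monoid_ring dest: base_C)
  also have "\<dots> = ract r (prj n f)"
    unfolding prj_def using sum_comp_morphism[of "ract r" "\<lambda>b. ract (f b) b" ?S]
    by (simp add: ract_lin o_def)
  finally show "prj n (r \<odot>\<^bsub>FM n\<^esub> f) = r \<odot>\<^bsub>bar n\<^esub> prj n f" by (simp add: bar_def)
next
  fix f g assume "f \<in> carrier (FM n)" "g \<in> carrier (FM n)"
  then show "prj n (f \<oplus>\<^bsub>FM n\<^esub> g) = prj n f \<oplus>\<^bsub>bar n\<^esub> prj n g"
    by (auto simp: bar_def free_module_def monoid_ring_def intro!: prj_add)
qed

private lemma prj_emb: "c \<in> C (Suc n) \<Longrightarrow> prj n (emb n c) = c"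
proof (induction c rule: C_induct)
  case zero
  then show ?case by (auto simp: prj_def emb_def comp_lin intro!: sum.neutral)
next
  case (one m)
  then obtain t l where m: "m = t # l" "t \<in> carrier T" "l \<in> L n" by (rule L_SucE)
  have "prj n (emb n (frag_of m)) = (\<Sum>b\<in>{frag_of (\<one> # l)}. ract (emb n (frag_of m) b) b)"
    using m by (intro prj_superset) (auto simp: base_def emb_def comp_def split: if_splits)
  also have "\<dots> = frag_of m"
    using m by (auto simp: emb_def base_def comp_def ract_lin) (simp add: act_def)
  finally show ?case .
next
  case (diff a b)
  have "prj n (emb n a) = prj n (emb n (a - b)) + prj n (emb n b)"
    by (intro prj_add emb_fin) (auto simp: emb_def comp_lin)
  then show ?case by (simp add: diff eq_diff_eq)
qed

private lemma bar_projective: "projective_module (monoid_ring T) (bar n)"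
  unfolding projective_module_def
proof (intro conjI exI bexI ballI)
  fix x assume "x \<in> carrier (bar n)"
  then show "prj n (emb n x) = x" by (simp add: prj_emb bar_def)
qed (rule bar_module emb_hom prj_hom)+

private lemma sum_coeff:
  assumes "Poly_Mapping.keys r \<subseteq> S" "finite S"
  shows "(\<Sum>s\<in>Poly_Mapping.keys r. Poly_Mapping.lookup r s) = (\<Sum>s\<in>S. Poly_Mapping.lookup r s)"
  using assms by (intro sum.mono_neutral_left) (auto simp: in_keys_iff)

private lemma aug_diff:
  "(\<Sum>s\<in>Poly_Mapping.keys (r - q). Poly_Mapping.lookup (r - q) s) =
   (\<Sum>s\<in>Poly_Mapping.keys r. Poly_Mapping.lookup r s) -
   (\<Sum>s\<in>Poly_Mapping.keys q. Poly_Mapping.lookup (q :: 'a \<Rightarrow>\<^sub>0 int) s)"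
proof -
  let ?S = "Poly_Mapping.keys r \<union> Poly_Mapping.keys q"
  show ?thesis
    unfolding sum_coeff[OF keys_diff finite_UnI[OF finite_keys finite_keys]]
      sum_coeff[of r ?S, OF Un_upper1 finite_UnI[OF finite_keys finite_keys]]
      sum_coeff[of q ?S, OF Un_upper2 finite_UnI[OF finite_keys finite_keys]]
    by (simp add: lookup_minus sum_subtractf)
qed

private lemma C_zero: "c \<in> C 0 \<Longrightarrow> c = frag_cmul (Poly_Mapping.lookup c []) (frag_of [])"
  by (intro poly_mapping_eqI) (auto simp: C_def L_def in_keys_iff)

private lemma ract_C_zero: "Poly_Mapping.keys r \<subseteq> carrier T \<Longrightarrow> c \<in> C 0 \<Longrightarrow> Poly_Mapping.lookup (ract r c) [] =
    (\<Sum>s\<in>Poly_Mapping.keys r. Poly_Mapping.lookup r s) * Poly_Mapping.lookup c []"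
proof (induction r rule: frag_induction)
  case (one s)
  have "act s c = c"
    by (subst (1 2) C_zero[OF one(2)]) (simp add: act_def frag_extend_cmul)
  then show ?case by (simp add: ract_lin)
qed (simp_all only: ract_lin aug_diff lookup_minus left_diff_distrib, simp_all)

lemma trivial_module_has_resolution:
  "\<exists>(P :: nat \<Rightarrow> ('a \<Rightarrow>\<^sub>0 int, 'a list \<Rightarrow>\<^sub>0 int) module) d \<epsilon>.
     projective_resolution (monoid_ring T) trivial_module P d \<epsilon>"
proof (intro exI)
  let ?e = "\<lambda>c. Poly_Mapping.lookup (D c) []"
  have D0: "D c = 0 \<longleftrightarrow> ?e c = 0" if "c \<in> C (Suc 0)" for c
    using C_zero[OF D_C[OF that]] by (metis frag_cmul_zero lookup_zero)
  have surj: "k \<in> ?e ` C (Suc 0)" for k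
  proof
    have "D (frag_of [\<one>]) = frag_of []" by (simp add: D_def hty_lin) (simp add: act_def)
    then show "k = ?e (frag_cmul k (frag_of [\<one>]))" by (simp add: D_def frag_extend_cmul)
    show "frag_cmul k (frag_of [\<one>]) \<in> C (Suc 0)" by (auto simp: C_def L_def)
  qed
  show "projective_resolution (monoid_ring T) trivial_module bar (\<lambda>_. D) ?e"
    unfolding projective_resolution_def
  proof (intro conjI allI)
    show "D \<in> mod_hom (monoid_ring T) (bar (Suc n)) (bar n)" for n
      by (auto simp: mod_hom_def bar_def D_C D_lin keys_monoid_ring D_ract)
    show "?e \<in> mod_hom (monoid_ring T) (bar 0) trivial_module"
      by (auto simp: mod_hom_def bar_def trivial_module_def D_lin lookup_add keys_monoid_ring
          D_ract ract_C_zero D_C)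
    show "?e ` carrier (bar 0) = carrier trivial_module"
      using surj by (auto simp: bar_def trivial_module_def)
    show "{x \<in> carrier (bar 0). ?e x = \<zero>\<^bsub>trivial_module :: ('a \<Rightarrow>\<^sub>0 int, int) module\<^esub>} = D ` carrier (bar 1)"
      using exact[of 0] D0 by (auto simp: bar_def trivial_module_def)
    show "{x \<in> carrier (bar (Suc n)). D x = \<zero>\<^bsub>bar n\<^esub>} = D ` carrier (bar (Suc (Suc n)))" for n
      using exact[of "Suc n"] by (simp add: bar_def)
  qed (rule bar_projective)
qed

end

end

theory Submission
  imports Defs "HOL-Algebra.AbelCoset" "HOL-Algebra.Free_Abelian_Groups" "HOL-Library.Countable"
begin

text \<open>Both monoids \<open>T\<close> map onto the free group in such a way that right multiplication by some idempotent
  \<open>e\<close> factors through this map: \<open>e = (1, X)\<close> for the free Clifford monoid and \<open>e = 1\<close> for its maximum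
  group image.  Let \<open>P\<close> be any projective resolution of the trivial module and \<open>p \<in> P 0\<close> an element
  of augmentation \<open>1\<close> with \<open>e p = p\<close>.  As the group is free, the derivation \<open>t \<mapsto> t p - p\<close> lifts
  through \<open>P 1 \<rightarrow> P 0\<close> to a derivation \<open>T \<rightarrow> P 1\<close>.  Extending it linearly and using that \<open>P 0\<close> is
  projective yields a section of \<open>P 1 \<rightarrow> ker \<epsilon>\<close>; from there the resolution splits degree by
  degree, and the cohomology vanishes from degree two on, with no comparison of resolutions.  In degree
  one, the exponent sum of words defines a nonzero class with trivial integer coefficients.\<close>

section \<open>Homomorphisms of left modules\<close>

text \<open>Behind the construction stands a short resolution that is never written down. The left
  ideal \<open>T e\<close> is a copy of the free group and \<open>ZT e\<close> is a direct summand
  of \<open>ZT\<close>, hence projective. The augmentation ideal of a free group ring is free on the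
  elements \<open>x - 1\<close>, so the trivial module is the quotient of \<open>ZT e\<close> by a
  direct sum of copies of \<open>ZT e\<close> indexed by \<open>X\<close>. A homomorphism from
  \<open>ZT e\<close> to \<open>P 0\<close> is an element \<open>p\<close> with
  \<open>e p = p\<close>, which explains this condition; the derivation encodes the map one degree
  higher. The obstacle is that \<open>Ext\<close> selects its resolution by \<open>SOME\<close>, so
  nothing is known about \<open>P\<close> beyond the axioms. The bridge from an arbitrary
  \<open>P\<close> to the monoid is a lift \<open>h\<close> of \<open>\<epsilon>\<close> along the
  augmentation of the monoid ring: composing with \<open>h\<close> carries functions on
  \<open>T\<close>, extended additively, over to \<open>P 0\<close>. The derivation, for the upper
  bound, and the exponent sum, for the lower bound, enter in this same way.\<close>

lemma mod_homI:
  assumes "\<And>x. x \<in> carrier M \<Longrightarrow> f x \<in> carrier N"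
    and "\<And>x y. \<lbrakk>x \<in> carrier M; y \<in> carrier M\<rbrakk> \<Longrightarrow> f (x \<oplus>\<^bsub>M\<^esub> y) = f x \<oplus>\<^bsub>N\<^esub> f y"
    and "\<And>a x. \<lbrakk>a \<in> carrier R; x \<in> carrier M\<rbrakk> \<Longrightarrow> f (a \<odot>\<^bsub>M\<^esub> x) = a \<odot>\<^bsub>N\<^esub> f x"
  shows "f \<in> mod_hom R M N"
  using assms by (auto simp: mod_hom_def)

lemma mod_homD:
  assumes "f \<in> mod_hom R M N"
  shows mod_hom_closed: "x \<in> carrier M \<Longrightarrow> f x \<in> carrier N"
    and mod_hom_add: "\<lbrakk>x \<in> carrier M; y \<in> carrier M\<rbrakk> \<Longrightarrow> f (x \<oplus>\<^bsub>M\<^esub> y) = f x \<oplus>\<^bsub>N\<^esub> f y"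
    and mod_hom_smult: "\<lbrakk>a \<in> carrier R; x \<in> carrier M\<rbrakk> \<Longrightarrow> f (a \<odot>\<^bsub>M\<^esub> x) = a \<odot>\<^bsub>N\<^esub> f x"
  using assms by (auto simp: mod_hom_def)

lemma mod_hom_comp:
  assumes "f \<in> mod_hom R M N" "g \<in> mod_hom R N L"
  shows "(\<lambda>x. g (f x)) \<in> mod_hom R M L"
  using assms by (intro mod_homI) (simp_all add: mod_homD[OF assms(1)] mod_homD[OF assms(2)])

lemma (in abelian_group) diff_eq_zero_iff:
  assumes "x \<in> carrier G" "y \<in> carrier G"
  shows "x \<ominus> y = \<zero> \<longleftrightarrow> x = y"
proof
  assume "x \<ominus> y = \<zero>"
  then have "(x \<ominus> y) \<oplus> y = y" using assms by simp
  then show "x = y" using assms by (simp add: minus_eq a_assoc l_neg)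
qed (use assms in \<open>simp add: minus_eq r_neg\<close>)

context left_module
begin

lemma smult_l_zero: "x \<in> carrier M \<Longrightarrow> \<zero> \<odot>\<^bsub>M\<^esub> x = \<zero>\<^bsub>M\<^esub>"
  using lsmult_l_distr[of \<zero> \<zero> x] lsmult_closed[of \<zero> x] M.add.l_cancel_one'[of "\<zero> \<odot>\<^bsub>M\<^esub> x" "\<zero> \<odot>\<^bsub>M\<^esub> x"]
  by simp

lemma smult_r_zero: "a \<in> carrier R \<Longrightarrow> a \<odot>\<^bsub>M\<^esub> \<zero>\<^bsub>M\<^esub> = \<zero>\<^bsub>M\<^esub>"
  using lsmult_r_distr[of a "\<zero>\<^bsub>M\<^esub>" "\<zero>\<^bsub>M\<^esub>"] lsmult_closed[of a "\<zero>\<^bsub>M\<^esub>"]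
    M.add.l_cancel_one'[of "a \<odot>\<^bsub>M\<^esub> \<zero>\<^bsub>M\<^esub>" "a \<odot>\<^bsub>M\<^esub> \<zero>\<^bsub>M\<^esub>"]
  by simp

lemma smult_r_minus:
  assumes "a \<in> carrier R" "x \<in> carrier M"
  shows "a \<odot>\<^bsub>M\<^esub> (\<ominus>\<^bsub>M\<^esub> x) = \<ominus>\<^bsub>M\<^esub> (a \<odot>\<^bsub>M\<^esub> x)"
proof -
  have "a \<odot>\<^bsub>M\<^esub> (\<ominus>\<^bsub>M\<^esub> x) \<oplus>\<^bsub>M\<^esub> a \<odot>\<^bsub>M\<^esub> x = \<zero>\<^bsub>M\<^esub>"
    using assms by (simp add: lsmult_r_distr[symmetric] M.l_neg smult_r_zero)
  then show ?thesis using assms by (simp add: M.minus_equality lsmult_closed)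
qed

lemma smult_l_minus:
  assumes "a \<in> carrier R" "x \<in> carrier M"
  shows "(\<ominus> a) \<odot>\<^bsub>M\<^esub> x = \<ominus>\<^bsub>M\<^esub> (a \<odot>\<^bsub>M\<^esub> x)"
proof -
  have "(\<ominus> a) \<odot>\<^bsub>M\<^esub> x \<oplus>\<^bsub>M\<^esub> a \<odot>\<^bsub>M\<^esub> x = \<zero>\<^bsub>M\<^esub>"
    using assms by (simp add: lsmult_l_distr[symmetric] R.l_neg smult_l_zero)
  then show ?thesis using assms by (simp add: M.minus_equality lsmult_closed)
qed

lemma smult_r_diff:
  "\<lbrakk>a \<in> carrier R; x \<in> carrier M; y \<in> carrier M\<rbrakk> \<Longrightarrow>
    a \<odot>\<^bsub>M\<^esub> (x \<ominus>\<^bsub>M\<^esub> y) = a \<odot>\<^bsub>M\<^esub> x \<ominus>\<^bsub>M\<^esub> a \<odot>\<^bsub>M\<^esub> y"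
  by (simp add: M.minus_eq lsmult_r_distr smult_r_minus)

lemma smult_l_diff:
  "\<lbrakk>a \<in> carrier R; b \<in> carrier R; x \<in> carrier M\<rbrakk> \<Longrightarrow>
    (a \<ominus> b) \<odot>\<^bsub>M\<^esub> x = a \<odot>\<^bsub>M\<^esub> x \<ominus>\<^bsub>M\<^esub> b \<odot>\<^bsub>M\<^esub> x"
  by (simp add: M.minus_eq R.minus_eq lsmult_l_distr smult_l_minus)

lemma smult_finsum:
  assumes "finite S" "a \<in> carrier R" "f \<in> S \<rightarrow> carrier M"
  shows "a \<odot>\<^bsub>M\<^esub> (\<Oplus>\<^bsub>M\<^esub>i\<in>S. f i) = (\<Oplus>\<^bsub>M\<^esub>i\<in>S. a \<odot>\<^bsub>M\<^esub> f i)"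
  using assms
proof (induction S rule: finite_induct)
  case (insert i S)
  then have "f i \<in> carrier M" "f \<in> S \<rightarrow> carrier M" by auto
  with insert show ?case by (simp add: Pi_iff lsmult_r_distr lsmult_closed)
qed (simp add: smult_r_zero)

end

lemma mod_hom_abelian_group_hom:
  assumes "left_module R M" "left_module R N" "f \<in> mod_hom R M N"
  shows "abelian_group_hom M N f"
proof -
  interpret M: left_module R M by fact
  interpret N: left_module R N by fact
  show ?thesis
    by (intro abelian_group_homI group_hom.intro group_hom_axioms.intro M.abelian_group_axioms
        N.abelian_group_axioms M.add.is_group N.add.is_group)
      (auto simp: hom_def mod_homD[OF assms(3)])
qed

lemma mod_hom_diff:
  assumes "left_module R M" "left_module R N" "f \<in> mod_hom R M N"
    and "x \<in> carrier M" "y \<in> carrier M"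
  shows "f (x \<ominus>\<^bsub>M\<^esub> y) = f x \<ominus>\<^bsub>N\<^esub> f y"
proof -
  interpret abelian_group_hom M N f by (rule mod_hom_abelian_group_hom) fact+
  show ?thesis using assms(4,5) by (simp add: G.minus_eq H.minus_eq)
qed

lemma mod_hom_zero:
  assumes "left_module R M" "left_module R N" "f \<in> mod_hom R M N"
  shows "f \<zero>\<^bsub>M\<^esub> = \<zero>\<^bsub>N\<^esub>"
proof -
  interpret abelian_group_hom M N f by (rule mod_hom_abelian_group_hom) fact+
  show ?thesis by simp
qed

section \<open>Lifting along surjections\<close>

definition free_basis :: "('r, 'a) ring_scheme \<Rightarrow> 'b set \<Rightarrow> 'b \<Rightarrow> 'b \<Rightarrow> 'r"
  where "free_basis R B b = (\<lambda>c\<in>B. if c = b then \<one>\<^bsub>R\<^esub> else \<zero>\<^bsub>R\<^esub>)"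

lemma free_basis_closed:
  assumes "ring R" "b \<in> B"
  shows "free_basis R B b \<in> carrier (free_module R B)"
proof -
  interpret ring R by fact
  have "{c \<in> B. free_basis R B b c \<noteq> \<zero>\<^bsub>R\<^esub>} \<subseteq> {b}"
    by (auto simp: free_basis_def split: if_splits)
  then have "finite {c \<in> B. free_basis R B b c \<noteq> \<zero>\<^bsub>R\<^esub>}"
    by (rule finite_subset) simp
  then show ?thesis by (auto simp: free_module_def free_basis_def)
qed

text \<open>A finitely supported vector is exhausted by peeling off one coordinate at a time. The
  resulting uniqueness is what \<open>projective_module_lift\<close> needs to compare two
  homomorphisms on a free module.\<close>

lemma free_module_hom_expansion:
  assumes "left_module R N" "\<psi> \<in> mod_hom R (free_module R B) N" "f \<in> carrier (free_module R B)"
  shows "\<psi> f = (\<Oplus>\<^bsub>N\<^esub>b\<in>{b \<in> B. f b \<noteq> \<zero>\<^bsub>R\<^esub>}. f b \<odot>\<^bsub>N\<^esub> \<psi> (free_basis R B b))"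
proof -
  interpret N: left_module R N by fact
  note \<psi> = mod_homD[OF assms(2)]
  note ring = N.ring_axioms
  have F: "h \<in> carrier (free_module R B) \<longleftrightarrow> h \<in> B \<rightarrow>\<^sub>E carrier R \<and> finite {b \<in> B. h b \<noteq> \<zero>\<^bsub>R\<^esub>}" for h
    by (simp add: free_module_def)
  \<comment> \<open>The support is relaxed to any finite \<open>S\<close> containing it, so that
    clearing the coordinate \<open>b\<close> always passes from \<open>insert b S\<close> to
    \<open>S\<close>.\<close>
  have "\<psi> h = (\<Oplus>\<^bsub>N\<^esub>b\<in>S. h b \<odot>\<^bsub>N\<^esub> \<psi> (free_basis R B b))"
    if "finite S" "h \<in> carrier (free_module R B)" "S \<subseteq> B" "{b \<in> B. h b \<noteq> \<zero>\<^bsub>R\<^esub>} \<subseteq> S" for h S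
    using that
  proof (induction S arbitrary: h rule: finite_induct)
    case empty
    then have h: "h = (\<lambda>b\<in>B. \<zero>\<^bsub>R\<^esub>)" by (auto simp: F PiE_iff extensional_def fun_eq_iff)
    \<comment> \<open>\<open>free_module R B\<close> is not known to be a left module here, so the
      value at zero is read off from \<open>h + h = h\<close> by cancelling in
      \<open>N\<close>.\<close>
    have "h \<oplus>\<^bsub>free_module R B\<^esub> h = h" by (auto simp: h free_module_def fun_eq_iff)
    then have "\<psi> h = \<psi> h \<oplus>\<^bsub>N\<^esub> \<psi> h" using \<psi>(2)[OF empty(1) empty(1)] by metis
    then have "\<psi> h = \<zero>\<^bsub>N\<^esub>" using \<psi>(1)[OF empty(1)] by (metis N.add.l_cancel_one')
    then show ?case by simp
  next
    case (insert b S)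
    define h' where "h' = h(b := \<zero>\<^bsub>R\<^esub>)"
    have b: "b \<in> B" and S: "S \<subseteq> B" using insert by auto
    have hR: "h c \<in> carrier R" if "c \<in> B" for c using insert.prems(1) that by (auto simp: F)
    have supp: "{c \<in> B. h' c \<noteq> \<zero>\<^bsub>R\<^esub>} \<subseteq> S" using insert.prems(3) by (auto simp: h'_def)
    have h': "h' \<in> carrier (free_module R B)"
      using finite_subset[OF supp insert.hyps(1)] insert.prems(1) b
      by (auto simp: F h'_def PiE_iff extensional_def)
    let ?b = "free_basis R B b"
    have bc: "?b \<in> carrier (free_module R B)" using b by (rule free_basis_closed[OF ring])
    have hb: "h b \<odot>\<^bsub>free_module R B\<^esub> ?b \<in> carrier (free_module R B)"
    proof -
      have "{c \<in> B. (h b \<odot>\<^bsub>free_module R B\<^esub> ?b) c \<noteq> \<zero>\<^bsub>R\<^esub>} \<subseteq> {b}"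
        using hR[OF b] by (auto simp: free_module_def free_basis_def split: if_splits)
      then have "finite {c \<in> B. (h b \<odot>\<^bsub>free_module R B\<^esub> ?b) c \<noteq> \<zero>\<^bsub>R\<^esub>}"
        by (rule finite_subset) simp
      then show ?thesis
        unfolding F using hR[OF b] by (auto simp: free_module_def free_basis_def)
    qed
    have "h = h' \<oplus>\<^bsub>free_module R B\<^esub> (h b \<odot>\<^bsub>free_module R B\<^esub> ?b)"
      using insert.prems(1) hR b
      by (auto simp: F free_module_def free_basis_def h'_def fun_eq_iff PiE_iff extensional_def)
    then have "\<psi> h = \<psi> h' \<oplus>\<^bsub>N\<^esub> h b \<odot>\<^bsub>N\<^esub> \<psi> ?b"
      using \<psi>(2)[OF h' hb] \<psi>(3)[OF hR[OF b] bc] by simp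
    also have "\<psi> h' = (\<Oplus>\<^bsub>N\<^esub>c\<in>S. h' c \<odot>\<^bsub>N\<^esub> \<psi> (free_basis R B c))"
      using insert.IH[OF h' S supp] .
    also have "\<dots> = (\<Oplus>\<^bsub>N\<^esub>c\<in>S. h c \<odot>\<^bsub>N\<^esub> \<psi> (free_basis R B c))"
      using insert.hyps(2) S hR \<psi>(1)[OF free_basis_closed[OF ring]]
      by (intro N.finsum_cong') (auto simp: h'_def intro!: N.lsmult_closed)
    finally show ?case
      using insert.hyps S b hR \<psi>(1)[OF free_basis_closed[OF ring]]
      by (subst N.finsum_insert)
        (auto simp: Pi_iff intro!: N.lsmult_closed N.finsum_closed N.add.m_comm)
  qed
  from this[of "{b \<in> B. f b \<noteq> \<zero>\<^bsub>R\<^esub>}" f] show ?thesis using assms(3) by (auto simp: F)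
qed

lemma free_module_hom_exists:
  assumes "left_module R A" "a \<in> B \<rightarrow> carrier A"
  obtains h where "h \<in> mod_hom R (free_module R B) A" "\<And>b. b \<in> B \<Longrightarrow> h (free_basis R B b) = a b"
proof -
  interpret A: left_module R A by fact
  define h where "h f = (\<Oplus>\<^bsub>A\<^esub>b\<in>{b \<in> B. f b \<noteq> \<zero>\<^bsub>R\<^esub>}. f b \<odot>\<^bsub>A\<^esub> a b)" for f
  have F: "f \<in> carrier (free_module R B) \<longleftrightarrow> f \<in> B \<rightarrow>\<^sub>E carrier R \<and> finite {b \<in> B. f b \<noteq> \<zero>\<^bsub>R\<^esub>}" for f
    by (simp add: free_module_def)
  have cl: "f b \<odot>\<^bsub>A\<^esub> a b \<in> carrier A" if "f \<in> B \<rightarrow> carrier R" "b \<in> B" for f b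
    using assms(2) that by (auto intro!: A.lsmult_closed)
  \<comment> \<open>The supports of \<open>f\<close>, \<open>g\<close> and their sum differ; over a
    common finite superset, where the extra terms vanish, linearity can be checked termwise.\<close>
  have eq: "h f = (\<Oplus>\<^bsub>A\<^esub>b\<in>S. f b \<odot>\<^bsub>A\<^esub> a b)"
    if "f \<in> B \<rightarrow> carrier R" "finite S" "{b \<in> B. f b \<noteq> \<zero>\<^bsub>R\<^esub>} \<subseteq> S" "S \<subseteq> B" for f S
    unfolding h_def using that assms(2)
    by (intro A.add.finprod_mono_neutral_cong_left) (auto simp: cl A.smult_l_zero Pi_iff)
  show thesis
  proof
    show "h \<in> mod_hom R (free_module R B) A"
    proof (rule mod_homI)
      fix f assume f: "f \<in> carrier (free_module R B)"
      then show "h f \<in> carrier A" by (auto simp: h_def F intro!: A.finsum_closed cl)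
      let ?S = "{b \<in> B. f b \<noteq> \<zero>\<^bsub>R\<^esub>}"
      fix r assume r: "r \<in> carrier R"
      have "h (r \<odot>\<^bsub>free_module R B\<^esub> f) = (\<Oplus>\<^bsub>A\<^esub>b\<in>?S. (r \<odot>\<^bsub>free_module R B\<^esub> f) b \<odot>\<^bsub>A\<^esub> a b)"
        using f r by (intro eq) (auto simp: F, auto simp: free_module_def)
      also have "\<dots> = (\<Oplus>\<^bsub>A\<^esub>b\<in>?S. r \<odot>\<^bsub>A\<^esub> (f b \<odot>\<^bsub>A\<^esub> a b))"
        using f r assms(2)
        by (intro A.finsum_cong') (auto simp: F free_module_def A.lsmult_assoc Pi_iff PiE_iff
            intro!: A.lsmult_closed)
      also have "\<dots> = r \<odot>\<^bsub>A\<^esub> h f"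
        unfolding h_def using f r by (intro A.smult_finsum[symmetric]) (auto simp: F cl PiE_iff Pi_iff)
      finally show "h (r \<odot>\<^bsub>free_module R B\<^esub> f) = r \<odot>\<^bsub>A\<^esub> h f" .
    next
      fix f g assume f: "f \<in> carrier (free_module R B)" and g: "g \<in> carrier (free_module R B)"
      let ?S = "{b \<in> B. f b \<noteq> \<zero>\<^bsub>R\<^esub>} \<union> {b \<in> B. g b \<noteq> \<zero>\<^bsub>R\<^esub>}"
      have "h (f \<oplus>\<^bsub>free_module R B\<^esub> g) =
          (\<Oplus>\<^bsub>A\<^esub>b\<in>?S. (f \<oplus>\<^bsub>free_module R B\<^esub> g) b \<odot>\<^bsub>A\<^esub> a b)"
        using f g by (intro eq) (auto simp: F, auto simp: free_module_def)
      also have "\<dots> = (\<Oplus>\<^bsub>A\<^esub>b\<in>?S. f b \<odot>\<^bsub>A\<^esub> a b \<oplus>\<^bsub>A\<^esub> g b \<odot>\<^bsub>A\<^esub> a b)"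
        using f g assms(2)
        by (intro A.finsum_cong') (auto simp: F free_module_def A.lsmult_l_distr Pi_iff PiE_iff
            intro!: A.lsmult_closed A.add.m_closed)
      also have "\<dots> = (\<Oplus>\<^bsub>A\<^esub>b\<in>?S. f b \<odot>\<^bsub>A\<^esub> a b) \<oplus>\<^bsub>A\<^esub> (\<Oplus>\<^bsub>A\<^esub>b\<in>?S. g b \<odot>\<^bsub>A\<^esub> a b)"
        using f g by (intro A.finsum_addf) (auto simp: F cl PiE_iff Pi_iff)
      also have "\<dots> = h f \<oplus>\<^bsub>A\<^esub> h g"
        using f g eq[of f ?S] eq[of g ?S] by (auto simp: F PiE_iff Pi_iff)
      finally show "h (f \<oplus>\<^bsub>free_module R B\<^esub> g) = h f \<oplus>\<^bsub>A\<^esub> h g" .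
    qed
    show "h (free_basis R B b) = a b" if "b \<in> B" for b
    proof -
      have "h (free_basis R B b) = (\<Oplus>\<^bsub>A\<^esub>c\<in>{b}. free_basis R B b c \<odot>\<^bsub>A\<^esub> a c)"
        using that by (intro eq) (auto simp: free_basis_def split: if_splits)
      also have "\<dots> = a b"
        using that assms(2) by (simp add: free_basis_def Pi_iff A.lsmult_one)
      finally show ?thesis .
    qed
  qed
qed

text \<open>The images of the unit vectors under \<open>\<alpha> \<circ> q\<close> are lifted one by
  one, \<open>h\<close> extends this choice to the free module, and precomposing with
  \<open>i\<close> gives the lift because \<open>q \<circ> i\<close> is the identity. Comparing
  images, instead of asking \<open>\<beta>\<close> to be onto, spares turning kernels into
  modules.\<close>

lemma projective_module_lift:
  assumes P: "projective_module R P" and A: "left_module R A" and B: "left_module R B"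
    and \<beta>: "\<beta> \<in> mod_hom R A B" and \<alpha>: "\<alpha> \<in> mod_hom R P B"
    and sub: "\<alpha> ` carrier P \<subseteq> \<beta> ` carrier A"
  obtains l where "l \<in> mod_hom R P A" "\<And>x. x \<in> carrier P \<Longrightarrow> \<beta> (l x) = \<alpha> x"
proof -
  obtain C :: "'c set" and i q where i: "i \<in> mod_hom R P (free_module R C)"
    and q: "q \<in> mod_hom R (free_module R C) P" and qi: "\<And>x. x \<in> carrier P \<Longrightarrow> q (i x) = x"
    using P unfolding projective_module_def by blast
  interpret A: left_module R A by fact
  interpret B: left_module R B by fact
  have basis: "free_basis R C b \<in> carrier (free_module R C)" if "b \<in> C" for b
    using that by (rule free_basis_closed[OF A.ring_axioms])
  have "\<exists>a\<in>carrier A. \<beta> a = \<alpha> (q (free_basis R C b))" if "b \<in> C" for b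
    using subsetD[OF sub imageI[OF mod_hom_closed[OF q basis[OF that]]]] by (metis imageE)
  then obtain a where a: "\<And>b. b \<in> C \<Longrightarrow> a b \<in> carrier A \<and> \<beta> (a b) = \<alpha> (q (free_basis R C b))"
    by metis
  then have "a \<in> C \<rightarrow> carrier A" by blast
  then obtain h where h: "h \<in> mod_hom R (free_module R C) A"
    "\<And>b. b \<in> C \<Longrightarrow> h (free_basis R C b) = a b"
    using free_module_hom_exists[OF A] by metis
  have eq: "\<beta> (h f) = \<alpha> (q f)" if f: "f \<in> carrier (free_module R C)" for f
    unfolding free_module_hom_expansion[OF B mod_hom_comp[OF h(1) \<beta>] f]
      free_module_hom_expansion[OF B mod_hom_comp[OF q \<alpha>] f]
    using f h(2) a mod_hom_closed[OF \<alpha>] mod_hom_closed[OF q] basis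
    by (intro B.finsum_cong') (auto simp: free_module_def intro!: B.lsmult_closed)
  show thesis
  proof
    show "(\<lambda>x. h (i x)) \<in> mod_hom R P A" using i h(1) by (rule mod_hom_comp)
    show "\<beta> (h (i x)) = \<alpha> x" if "x \<in> carrier P" for x
      using that eq mod_hom_closed[OF i] qi by simp
  qed
qed

section \<open>Cohomology of Hom complexes\<close>

text \<open>The conditions in \<open>mod_hom\<close> look only at carrier elements, and the carrier
  is closed under the operations. So the extensionality demanded by \<open>Hom_group\<close> can be
  imposed afterwards.\<close>

lemma mod_hom_ext_iff:
  assumes "left_module R M"
  shows "(\<lambda>x\<in>carrier M. f x) \<in> mod_hom R M N \<longleftrightarrow> f \<in> mod_hom R M N"
proof -
  interpret M: left_module R M by fact
  show ?thesis by (auto simp: mod_hom_def Pi_iff M.lsmult_closed)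
qed

lemma comm_group_Hom_group:
  assumes "left_module R M" "left_module R N"
  shows "comm_group (Hom_group R M N)"
proof -
  interpret M: left_module R M by fact
  interpret N: left_module R N by fact
  show ?thesis
  proof (rule comm_groupI)
    fix f assume f: "f \<in> carrier (Hom_group R M N)"
    let ?g = "\<lambda>x\<in>carrier M. \<ominus>\<^bsub>N\<^esub> f x"
    have "?g \<in> mod_hom R M N"
      unfolding mod_hom_ext_iff[OF assms(1)] using f
      by (intro mod_homI)
        (auto simp: Hom_group_def mod_hom_closed mod_hom_add mod_hom_smult N.minus_add N.smult_r_minus)
    then show "\<exists>g\<in>carrier (Hom_group R M N). g \<otimes>\<^bsub>Hom_group R M N\<^esub> f = \<one>\<^bsub>Hom_group R M N\<^esub>"
      using f by (intro bexI[of _ ?g]) (auto simp: Hom_group_def mod_hom_closed N.l_neg)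
    show "\<one>\<^bsub>Hom_group R M N\<^esub> \<otimes>\<^bsub>Hom_group R M N\<^esub> f = f"
      using f by (auto simp: Hom_group_def mod_hom_closed extensional_def fun_eq_iff)
    fix g assume g: "g \<in> carrier (Hom_group R M N)"
    show "f \<otimes>\<^bsub>Hom_group R M N\<^esub> g \<in> carrier (Hom_group R M N)"
    proof -
      have "(\<lambda>x. f x \<oplus>\<^bsub>N\<^esub> g x) \<in> mod_hom R M N"
        using f g by (intro mod_homI)
          (auto simp: Hom_group_def mod_hom_closed mod_hom_add mod_hom_smult N.lsmult_r_distr N.a_ac)
      then show ?thesis by (simp add: Hom_group_def mod_hom_ext_iff[OF assms(1)])
    qed
    show "f \<otimes>\<^bsub>Hom_group R M N\<^esub> g = g \<otimes>\<^bsub>Hom_group R M N\<^esub> f"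
      using f g by (auto simp: Hom_group_def mod_hom_closed N.a_comm intro!: restrict_ext)
    fix h assume h: "h \<in> carrier (Hom_group R M N)"
    show "f \<otimes>\<^bsub>Hom_group R M N\<^esub> g \<otimes>\<^bsub>Hom_group R M N\<^esub> h =
        f \<otimes>\<^bsub>Hom_group R M N\<^esub> (g \<otimes>\<^bsub>Hom_group R M N\<^esub> h)"
      using f g h by (auto simp: Hom_group_def mod_hom_closed N.a_assoc intro!: restrict_ext)
  next
    have "(\<lambda>x. \<zero>\<^bsub>N\<^esub>) \<in> mod_hom R M N" by (intro mod_homI) (auto simp: N.smult_r_zero)
    then show "\<one>\<^bsub>Hom_group R M N\<^esub> \<in> carrier (Hom_group R M N)"
      by (simp add: Hom_group_def mod_hom_ext_iff[OF assms(1)])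
  qed
qed

text \<open>A coset equals \<open>H\<close> exactly when its representative lies in
  \<open>H\<close>.\<close>

lemma trivial_FactGroup_iff:
  assumes "comm_group K" "subgroup H K"
  shows "trivial_group (K Mod H) \<longleftrightarrow> carrier K \<subseteq> H"
proof -
  interpret comm_group K by fact
  interpret H: normal H K using assms(2) by (rule subgroup_imp_normal)
  show ?thesis
  proof
    assume "trivial_group (K Mod H)"
    then have "H #>\<^bsub>K\<^esub> x = H" if "x \<in> carrier K" for x
      using that by (auto simp: trivial_group_def carrier_FactGroup)
    then show "carrier K \<subseteq> H" using rcos_self[OF _ assms(2)] by blast
  next
    assume "carrier K \<subseteq> H"
    then have "H #>\<^bsub>K\<^esub> x = H" if "x \<in> carrier K" for x
      using that coset_join2[OF that assms(2)] by blast
    then show "trivial_group (K Mod H)"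
      unfolding trivial_group_def using H.factorgroup_is_group by (auto simp: carrier_FactGroup)
  qed
qed

lemma Hom_coboundary_hom:
  assumes "left_module R (P n)" "left_module R (P (Suc n))" "left_module R M"
    and "d n \<in> mod_hom R (P (Suc n)) (P n)"
  shows "Hom_coboundary P d n \<in> hom (Hom_group R (P n) M) (Hom_group R (P (Suc n)) M)"
proof (rule homI)
  fix f assume f: "f \<in> carrier (Hom_group R (P n) M)"
  then show "Hom_coboundary P d n f \<in> carrier (Hom_group R (P (Suc n)) M)"
    using mod_hom_comp[OF assms(4), of f M]
    by (simp add: Hom_group_def Hom_coboundary_def mod_hom_ext_iff[OF assms(2)])
next
  fix f g
  show "Hom_coboundary P d n (f \<otimes>\<^bsub>Hom_group R (P n) M\<^esub> g) =
      Hom_coboundary P d n f \<otimes>\<^bsub>Hom_group R (P (Suc n)) M\<^esub> Hom_coboundary P d n g"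
    using mod_hom_closed[OF assms(4)]
    by (auto simp: Hom_group_def Hom_coboundary_def intro!: restrict_ext)
qed

text \<open>Serves to work with plain cocycles and coboundaries, freed from quotient groups and
  extensional functions. By \<open>dd\<close> the coboundaries lie among the cocycles, where they
  form a subgroup.\<close>

lemma trivial_Hom_cohomology_Suc_iff:
  assumes P: "\<And>n. left_module R (P n)" and M: "left_module R M"
    and d: "\<And>n. d n \<in> mod_hom R (P (Suc n)) (P n)"
    and dd: "\<And>x. x \<in> carrier (P (Suc (Suc n))) \<Longrightarrow> d n (d (Suc n) x) = \<zero>\<^bsub>P n\<^esub>"
  shows "trivial_group (Hom_cohomology R P d M (Suc n)) \<longleftrightarrow>
    (\<forall>f\<in>mod_hom R (P (Suc n)) M. (\<forall>x\<in>carrier (P (Suc (Suc n))). f (d (Suc n) x) = \<zero>\<^bsub>M\<^esub>) \<longrightarrow>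
      (\<exists>g\<in>mod_hom R (P n) M. \<forall>x\<in>carrier (P (Suc n)). f x = g (d n x)))"
    (is "_ \<longleftrightarrow> ?rhs")
proof -
  let ?H = "\<lambda>n. Hom_group R (P n) M" and ?\<delta> = "Hom_coboundary P d"
  let ?Z = "kernel (?H (Suc n)) (?H (Suc (Suc n))) (?\<delta> (Suc n))" and ?B = "?\<delta> n ` carrier (?H n)"
  interpret H: comm_group "?H k" for k using P M by (rule comm_group_Hom_group)
  have hom: "?\<delta> k \<in> hom (?H k) (?H (Suc k))" for k
    by (rule Hom_coboundary_hom) (rule P M d)+
  interpret \<delta>: group_hom "?H k" "?H (Suc k)" "?\<delta> k" for k
    by unfold_locales (rule hom)
  have Z: "f \<in> ?Z \<longleftrightarrow> f \<in> carrier (?H (Suc n)) \<and>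
      (\<forall>x\<in>carrier (P (Suc (Suc n))). f (d (Suc n) x) = \<zero>\<^bsub>M\<^esub>)" for f
    by (auto simp: kernel_def Hom_group_def Hom_coboundary_def fun_eq_iff)
  have "?B \<subseteq> ?Z"
  proof
    fix f assume "f \<in> ?B"
    then obtain g where g: "f = ?\<delta> n g" "g \<in> carrier (?H n)" by blast
    then have "g \<zero>\<^bsub>P n\<^esub> = \<zero>\<^bsub>M\<^esub>" using mod_hom_zero[OF P M, of g n] by (simp add: Hom_group_def)
    with g show "f \<in> ?Z"
      using \<delta>.hom_closed[of g n] dd mod_hom_closed[OF d]
      by (simp add: Z) (simp add: Hom_coboundary_def)
  qed
  moreover have "subgroup ?Z (?H (Suc n))" by (rule \<delta>.subgroup_kernel)
  ultimately have sub: "subgroup ?B ((?H (Suc n))\<lparr>carrier := ?Z\<rparr>)"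
    using \<delta>.img_is_subgroup by (simp add: H.subgroup_incl)
  have comm: "comm_group ((?H (Suc n))\<lparr>carrier := ?Z\<rparr>)"
  proof (rule group.group_comm_groupI)
    show "group ((?H (Suc n))\<lparr>carrier := ?Z\<rparr>)"
      using subgroup.subgroup_is_group[OF \<delta>.subgroup_kernel H.is_group] .
  qed (auto simp: kernel_def intro: H.m_comm)
  have "trivial_group (Hom_cohomology R P d M (Suc n)) \<longleftrightarrow> ?Z \<subseteq> ?B"
    using trivial_FactGroup_iff[OF comm sub] by (simp add: Hom_cohomology_def)
  also have "\<dots> \<longleftrightarrow> ?rhs"
  proof
    assume sub: "?Z \<subseteq> ?B"
    show ?rhs
    proof (intro ballI impI)
      fix f assume f: "f \<in> mod_hom R (P (Suc n)) M"
        "\<forall>x\<in>carrier (P (Suc (Suc n))). f (d (Suc n) x) = \<zero>\<^bsub>M\<^esub>"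
      then have "restrict f (carrier (P (Suc n))) \<in> ?Z"
        unfolding Z using mod_hom_closed[OF d] by (simp add: Hom_group_def mod_hom_ext_iff[OF P])
      then obtain g where g: "restrict f (carrier (P (Suc n))) = ?\<delta> n g" "g \<in> carrier (?H n)"
        using sub by blast
      then have "f x = g (d n x)" if "x \<in> carrier (P (Suc n))" for x
        using that by (metis Hom_coboundary_def restrict_apply')
      with g(2) show "\<exists>g\<in>mod_hom R (P n) M. \<forall>x\<in>carrier (P (Suc n)). f x = g (d n x)"
        by (auto simp: Hom_group_def)
    qed
  next
    assume rhs: ?rhs
    show "?Z \<subseteq> ?B"
    proof
      fix f assume f: "f \<in> ?Z"
      then have "f \<in> mod_hom R (P (Suc n)) M" "f \<in> extensional (carrier (P (Suc n)))"
        unfolding Z by (simp_all add: Hom_group_def)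
      with rhs f obtain g where g: "g \<in> mod_hom R (P n) M" "\<forall>x\<in>carrier (P (Suc n)). f x = g (d n x)"
        unfolding Z by blast
      let ?g = "restrict g (carrier (P n))"
      have "?g \<in> carrier (?H n)" using g(1) by (simp add: Hom_group_def mod_hom_ext_iff[OF P])
      moreover have "f = ?\<delta> n ?g"
        using \<open>f \<in> extensional _\<close> g(2) mod_hom_closed[OF d]
        by (auto simp: Hom_coboundary_def fun_eq_iff extensional_def)
      ultimately show "f \<in> ?B" by blast
    qed
  qed
  finally show ?thesis .
qed

section \<open>The augmentation of a monoid ring\<close>

definition augmentation :: "('a \<Rightarrow>\<^sub>0 int) \<Rightarrow> int"
  where "augmentation r = (\<Sum>s\<in>Poly_Mapping.keys r. Poly_Mapping.lookup r s)"

lemma augmentation_superset: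
  assumes "finite S" "Poly_Mapping.keys r \<subseteq> S"
  shows "augmentation r = (\<Sum>s\<in>S. Poly_Mapping.lookup r s)"
  unfolding augmentation_def using assms by (intro sum.mono_neutral_left) (auto simp: in_keys_iff)

lemma augmentation_simps [simp]:
  "augmentation 0 = 0" "augmentation (frag_of s) = 1"
  "augmentation (r + q) = augmentation r + augmentation q"
  "augmentation (r - q) = augmentation r - augmentation q"
proof -
  have fin: "finite (Poly_Mapping.keys r \<union> Poly_Mapping.keys q)" by simp
  show "augmentation (r + q) = augmentation r + augmentation q"
    using augmentation_superset[OF fin, of r] augmentation_superset[OF fin, of q]
      augmentation_superset[OF fin Poly_Mapping.keys_add]
    by (simp add: lookup_add sum.distrib)
  show "augmentation (r - q) = augmentation r - augmentation q"
    using augmentation_superset[OF fin, of r] augmentation_superset[OF fin, of q]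
      augmentation_superset[OF fin keys_diff]
    by (simp add: lookup_minus sum_subtractf)
qed (simp_all add: augmentation_def)

lemma augmentation_cmul [simp]: "augmentation (frag_cmul k r) = k * augmentation r"
  using augmentation_superset[of "Poly_Mapping.keys r" "frag_cmul k r"]
  by (simp add: augmentation_def keys_cmul sum_distrib_left)

lemma monoid_ring_simps:
  "r \<in> carrier (monoid_ring T) \<longleftrightarrow> Poly_Mapping.keys r \<subseteq> carrier T"
  "r \<oplus>\<^bsub>monoid_ring T\<^esub> q = r + q" "\<zero>\<^bsub>monoid_ring T\<^esub> = 0" "\<one>\<^bsub>monoid_ring T\<^esub> = frag_of \<one>\<^bsub>T\<^esub>"
  by (simp_all add: monoid_ring_def)

text \<open>\<open>frag_induction\<close> produces differences of finitely supported functions,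
  while the module laws concern the subtraction of the ring record.\<close>

lemma (in monoid) monoid_ring_diff:
  assumes "r \<in> carrier (monoid_ring G)" "q \<in> carrier (monoid_ring G)"
  shows "r \<ominus>\<^bsub>monoid_ring G\<^esub> q = r - q"
proof -
  interpret R: ring "monoid_ring G" by (rule ring_monoid_ring) (rule monoid_axioms)
  have "- q \<in> carrier (monoid_ring G)" using assms(2) by (simp add: monoid_ring_simps)
  moreover have "- q \<oplus>\<^bsub>monoid_ring G\<^esub> q = \<zero>\<^bsub>monoid_ring G\<^esub>" by (simp add: monoid_ring_simps)
  ultimately have "\<ominus>\<^bsub>monoid_ring G\<^esub> q = - q" using assms(2) by (intro R.minus_equality)
  then show ?thesis by (simp add: R.minus_eq monoid_ring_simps)
qed

lemma (in monoid) augmentation_mult: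
  "augmentation (r \<otimes>\<^bsub>monoid_ring G\<^esub> q) = augmentation r * augmentation q"
  using subset_UNIV[of "Poly_Mapping.keys r"]
proof (induction r rule: frag_induction)
  case (one s)
  show ?case
    using subset_UNIV[of "Poly_Mapping.keys q"]
    by (induction q rule: frag_induction) (auto simp: monoid_ring_mult_lin[OF monoid_axioms])
qed (auto simp: monoid_ring_mult_lin[OF monoid_axioms] left_diff_distrib)

text \<open>The elements of \<open>T\<close> generate the monoid ring additively. Maps made from a
  derivation are controlled on \<open>T\<close> only, so they are checked there.\<close>

lemma mod_hom_monoid_ringI:
  assumes "monoid T" "left_module (monoid_ring T) M" "left_module (monoid_ring T) N"
    and cl: "\<And>x. x \<in> carrier M \<Longrightarrow> f x \<in> carrier N"
    and add: "\<And>x y. \<lbrakk>x \<in> carrier M; y \<in> carrier M\<rbrakk> \<Longrightarrow> f (x \<oplus>\<^bsub>M\<^esub> y) = f x \<oplus>\<^bsub>N\<^esub> f y"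
    and act: "\<And>t x. \<lbrakk>t \<in> carrier T; x \<in> carrier M\<rbrakk> \<Longrightarrow>
      f (frag_of t \<odot>\<^bsub>M\<^esub> x) = frag_of t \<odot>\<^bsub>N\<^esub> f x"
  shows "f \<in> mod_hom (monoid_ring T) M N"
proof (rule mod_homI)
  interpret T: monoid T by fact
  interpret M: left_module "monoid_ring T" M by fact
  interpret N: left_module "monoid_ring T" N by fact
  interpret f: abelian_group_hom M N f
    by (intro abelian_group_homI group_hom.intro group_hom_axioms.intro M.abelian_group_axioms
        N.abelian_group_axioms M.add.is_group N.add.is_group) (auto simp: hom_def cl add)
  fix r x assume r: "r \<in> carrier (monoid_ring T)" and x: "x \<in> carrier M"
  have "Poly_Mapping.keys r \<subseteq> carrier T" using r by (simp add: monoid_ring_simps)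
  then have "f (r \<odot>\<^bsub>M\<^esub> x) = r \<odot>\<^bsub>N\<^esub> f x \<and> r \<in> carrier (monoid_ring T)"
  proof (induction r rule: frag_induction)
    case zero
    then show ?case
      using x M.smult_l_zero[of x] N.smult_l_zero[of "f x"] by (simp add: monoid_ring_simps cl)
  next
    case (diff a b)
    have "a - b = a \<ominus>\<^bsub>monoid_ring T\<^esub> b" using diff by (simp add: T.monoid_ring_diff)
    with diff x show ?case
      by (simp add: M.smult_l_diff N.smult_l_diff cl M.minus_eq N.minus_eq M.lsmult_closed)
  qed (use x act in \<open>auto simp: monoid_ring_simps\<close>)
  then show "f (r \<odot>\<^bsub>M\<^esub> x) = r \<odot>\<^bsub>N\<^esub> f x" ..
qed (rule cl add; assumption)+

text \<open>The universal property of the free abelian group on \<open>S\<close>; it will turn a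
  derivation on \<open>T\<close> into an additive map on the monoid ring.\<close>

lemma additive_extension:
  assumes "abelian_group M" "f \<in> S \<rightarrow> carrier M"
  obtains K where "\<And>s. s \<in> S \<Longrightarrow> K (frag_of s) = f s"
    and "\<And>r. Poly_Mapping.keys r \<subseteq> S \<Longrightarrow> K r \<in> carrier M"
    and "K 0 = \<zero>\<^bsub>M\<^esub>"
    and "\<And>r q. \<lbrakk>Poly_Mapping.keys r \<subseteq> S; Poly_Mapping.keys q \<subseteq> S\<rbrakk> \<Longrightarrow> K (r + q) = K r \<oplus>\<^bsub>M\<^esub> K q"
    and "\<And>r q. \<lbrakk>Poly_Mapping.keys r \<subseteq> S; Poly_Mapping.keys q \<subseteq> S\<rbrakk> \<Longrightarrow> K (r - q) = K r \<ominus>\<^bsub>M\<^esub> K q"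
proof -
  interpret M: abelian_group M by fact
  have "f ` S \<subseteq> carrier (add_monoid M)" using assms(2) by auto
  then obtain K where K: "K \<in> hom (free_Abelian_group S) (add_monoid M)"
    "\<And>s. s \<in> S \<Longrightarrow> K (frag_of s) = f s"
    using comm_group.free_Abelian_group_universal[OF M.a_comm_group] by metis
  interpret K: group_hom "free_Abelian_group S" "add_monoid M" K
    by (simp add: group_hom_def group_hom_axioms_def K(1) M.add.is_group)
  have cl: "K r \<in> carrier M" if "Poly_Mapping.keys r \<subseteq> S" for r
    using K.hom_closed[of r] that by (simp add: free_Abelian_group_def)
  have add: "K (r + q) = K r \<oplus>\<^bsub>M\<^esub> K q"
    if "Poly_Mapping.keys r \<subseteq> S" "Poly_Mapping.keys q \<subseteq> S" for r q
    using K.hom_mult[of r q] that by (simp add: free_Abelian_group_def)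
  have zero: "K 0 = \<zero>\<^bsub>M\<^esub>"
    using K.hom_one by (simp add: free_Abelian_group_def)
  have "K (r - q) = K r \<ominus>\<^bsub>M\<^esub> K q"
    if "Poly_Mapping.keys r \<subseteq> S" "Poly_Mapping.keys q \<subseteq> S" for r q
  proof -
    have sub: "Poly_Mapping.keys (r - q) \<subseteq> S" using that keys_diff[of r q] by blast
    have "K r = K (r - q) \<oplus>\<^bsub>M\<^esub> K q" using add[OF sub that(2)] by simp
    then show ?thesis
      using cl[OF sub] cl[OF that(1)] cl[OF that(2)] by (simp add: M.minus_eq M.a_assoc M.r_neg)
  qed
  with K(2) cl zero add show thesis by (rule that)
qed

section \<open>The regular and the trivial module\<close>

definition regular_module :: "('r, 'a) ring_scheme \<Rightarrow> ('r, 'r) module"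
  where "regular_module R = \<lparr>carrier = carrier R, monoid.mult = undefined, one = undefined,
    ring.zero = \<zero>\<^bsub>R\<^esub>, add = (\<oplus>\<^bsub>R\<^esub>), smult = (\<otimes>\<^bsub>R\<^esub>)\<rparr>"

lemma (in ring) left_module_regular_module: "left_module R (regular_module R)"
proof -
  have "abelian_group (regular_module R)"
    by (rule abelian_groupI) (auto simp: regular_module_def a_ac intro: l_neg)
  then interpret M: abelian_group "regular_module R" .
  show ?thesis
    by unfold_locales (simp_all add: regular_module_def l_distr r_distr m_assoc)
qed

text \<open>Coefficient modules have their elements in a prescribed type, so the trivial module is transported
  there along an injection.\<close>

definition trivial_module_on :: "(int \<Rightarrow> 'm) \<Rightarrow> ('a \<Rightarrow>\<^sub>0 int, 'm) module"
  where "trivial_module_on j = \<lparr>carrier = range j, monoid.mult = undefined, one = undefined,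
    ring.zero = j 0, add = (\<lambda>x y. j (the_inv j x + the_inv j y)),
    smult = (\<lambda>r x. j (augmentation r * the_inv j x))\<rparr>"

lemma trivial_module_on_id: "trivial_module_on (\<lambda>k. k) = trivial_module"
  by (simp add: trivial_module_on_def trivial_module_def augmentation_def the_inv_into_def)

lemma trivial_module_on_simps:
  assumes "inj j"
  shows "carrier (trivial_module_on j) = range j" "\<zero>\<^bsub>trivial_module_on j\<^esub> = j 0"
    "j k \<oplus>\<^bsub>trivial_module_on j\<^esub> j l = j (k + l)"
    "r \<odot>\<^bsub>trivial_module_on j\<^esub> j k = j (augmentation r * k)"
  using assms by (simp_all add: trivial_module_on_def the_inv_f_f)

lemma (in monoid) left_module_trivial_module_on:
  assumes "inj j"
  shows "left_module (monoid_ring G) (trivial_module_on j)"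
proof -
  note [simp] = trivial_module_on_simps[OF assms]
  interpret R: ring "monoid_ring G" by (rule ring_monoid_ring) (rule monoid_axioms)
  have "abelian_group (trivial_module_on j)"
  proof (rule abelian_groupI)
    fix x assume "x \<in> carrier (trivial_module_on j)"
    then obtain k where "x = j k" by auto
    then show "\<exists>y\<in>carrier (trivial_module_on j). y \<oplus>\<^bsub>trivial_module_on j\<^esub> x = \<zero>\<^bsub>trivial_module_on j\<^esub>"
      by (intro bexI[of _ "j (- k)"]) simp_all
  qed (auto simp: ac_simps)
  then interpret M: abelian_group "trivial_module_on j" .
  show ?thesis
    by unfold_locales
      (auto simp: monoid_ring_simps augmentation_mult algebra_simps)
qed

lemma (in monoid) left_module_trivial_module: "left_module (monoid_ring G) trivial_module"
  using left_module_trivial_module_on[of "\<lambda>k. k"] by (simp add: trivial_module_on_id)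

lemma trivial_module_simps:
  "carrier trivial_module = UNIV" "\<zero>\<^bsub>trivial_module\<^esub> = 0" "k \<oplus>\<^bsub>trivial_module\<^esub> l = k + l"
  "r \<odot>\<^bsub>trivial_module\<^esub> k = augmentation r * k"
  by (simp_all add: trivial_module_def augmentation_def)

lemma (in monoid) trivial_module_diff: "k \<ominus>\<^bsub>trivial_module :: ('a \<Rightarrow>\<^sub>0 int, int) module\<^esub> l = k - l"
proof -
  let ?Z = "trivial_module :: ('a \<Rightarrow>\<^sub>0 int, int) module"
  interpret Z: left_module "monoid_ring G" ?Z by (rule left_module_trivial_module)
  have "\<ominus>\<^bsub>?Z\<^esub> l = - l" by (rule Z.minus_equality) (simp_all add: trivial_module_simps)
  then show ?thesis by (simp add: Z.minus_eq trivial_module_simps)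
qed

section \<open>Resolutions of the trivial module\<close>

locale trivial_resolution = monoid T for T :: "('a, 'b) monoid_scheme" (structure) +
  fixes P :: "nat \<Rightarrow> ('a \<Rightarrow>\<^sub>0 int, 'p) module" and d :: "nat \<Rightarrow> 'p \<Rightarrow> 'p" and \<epsilon> :: "'p \<Rightarrow> int"
  assumes resolution: "projective_resolution (monoid_ring T) trivial_module P d \<epsilon>"
begin

abbreviation "ZT \<equiv> monoid_ring T"

lemma projective: "projective_module ZT (P n)"
  and d_hom: "d n \<in> mod_hom ZT (P (Suc n)) (P n)"
  and \<epsilon>_hom: "\<epsilon> \<in> mod_hom ZT (P 0) trivial_module"
  and \<epsilon>_image: "\<epsilon> ` carrier (P 0) = UNIV"
  and exact_0: "{x \<in> carrier (P 0). \<epsilon> x = 0} = d 0 ` carrier (P 1)"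
  and exact_Suc: "{x \<in> carrier (P (Suc n)). d n x = \<zero>\<^bsub>P n\<^esub>} = d (Suc n) ` carrier (P (Suc (Suc n)))"
  using resolution by (simp_all add: projective_resolution_def trivial_module_simps)

sublocale P: left_module ZT "P n" for n
  using projective by (simp add: projective_module_def)

lemmas d_closed = mod_hom_closed[OF d_hom]
  and d_add = mod_hom_add[OF d_hom]
  and d_smult = mod_hom_smult[OF d_hom]
  and d_diff = mod_hom_diff[OF P.left_module_axioms P.left_module_axioms d_hom]

lemma d_d: "x \<in> carrier (P (Suc (Suc n))) \<Longrightarrow> d n (d (Suc n) x) = \<zero>\<^bsub>P n\<^esub>"
  using exact_Suc[of n] by blast

lemma \<epsilon>_d: "x \<in> carrier (P (Suc 0)) \<Longrightarrow> \<epsilon> (d 0 x) = 0"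
  using exact_0 by auto

lemma \<epsilon>_add: "\<lbrakk>x \<in> carrier (P 0); y \<in> carrier (P 0)\<rbrakk> \<Longrightarrow> \<epsilon> (x \<oplus>\<^bsub>P 0\<^esub> y) = \<epsilon> x + \<epsilon> y"
  using mod_hom_add[OF \<epsilon>_hom] by (simp add: trivial_module_simps)

lemma \<epsilon>_smult: "\<lbrakk>r \<in> carrier ZT; x \<in> carrier (P 0)\<rbrakk> \<Longrightarrow> \<epsilon> (r \<odot>\<^bsub>P 0\<^esub> x) = augmentation r * \<epsilon> x"
  using mod_hom_smult[OF \<epsilon>_hom] by (simp add: trivial_module_simps)

lemma \<epsilon>_diff: "\<lbrakk>x \<in> carrier (P 0); y \<in> carrier (P 0)\<rbrakk> \<Longrightarrow> \<epsilon> (x \<ominus>\<^bsub>P 0\<^esub> y) = \<epsilon> x - \<epsilon> y"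
  using mod_hom_diff[OF P.left_module_axioms left_module_trivial_module \<epsilon>_hom]
  by (simp add: trivial_module_diff)

lemma frag_of_ZT: "t \<in> carrier T \<Longrightarrow> frag_of t \<in> carrier ZT"
  by (simp add: monoid_ring_simps)

text \<open>\<open>P 0\<close> is projective and the augmentation is onto, since \<open>k\<close> is
  hit by \<open>k\<close> times the unit. Through \<open>h\<close>, additive maps on the monoid ring
  can be evaluated on elements of \<open>P 0\<close>.\<close>

lemma augmentation_lift:
  obtains h where "h \<in> mod_hom ZT (P 0) (regular_module ZT)"
    "\<And>y. y \<in> carrier (P 0) \<Longrightarrow> augmentation (h y) = \<epsilon> y"
proof -
  have aug: "augmentation \<in> mod_hom ZT (regular_module ZT) trivial_module"
    by (rule mod_homI)
      (auto simp: regular_module_def trivial_module_simps monoid_ring_simps augmentation_mult)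
  have "\<epsilon> ` carrier (P 0) \<subseteq> augmentation ` carrier (regular_module ZT)"
  proof
    fix k
    have "frag_cmul k (frag_of \<one>) \<in> carrier ZT" by (auto simp: monoid_ring_simps keys_cmul)
    moreover have "k = augmentation (frag_cmul k (frag_of \<one>))" by simp
    ultimately show "k \<in> augmentation ` carrier (regular_module ZT)"
      by (auto simp: regular_module_def simp del: augmentation_simps augmentation_cmul)
  qed
  with projective P.left_module_regular_module left_module_trivial_module aug \<epsilon>_hom show thesis
    using that by (rule projective_module_lift)
qed

section \<open>Splitting the resolution degree by degree\<close>

text \<open>As the image of \<open>d (Suc n)\<close> is the kernel of \<open>d n\<close>, such an
  \<open>S\<close> factors through the image of \<open>d n\<close> and amounts to a section of
  \<open>d n\<close> over it. The encoding as an endomorphism avoids a module structure on that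
  image.\<close>

definition split_at :: "nat \<Rightarrow> bool"
  where "split_at n \<longleftrightarrow> (\<exists>S\<in>mod_hom ZT (P (Suc n)) (P (Suc n)).
    (\<forall>x\<in>carrier (P (Suc n)). d n (S x) = d n x) \<and>
    (\<forall>x\<in>carrier (P (Suc (Suc n))). S (d (Suc n) x) = \<zero>\<^bsub>P (Suc n)\<^esub>))"

text \<open>Since \<open>d n (S x) = d n x\<close>, the element \<open>x - S x\<close> lies in the
  kernel of \<open>d n\<close>, that is, in the image of \<open>d (Suc n)\<close>, and projectivity
  lifts it to \<open>t x\<close>. On that image \<open>S\<close> vanishes, so there
  \<open>d (Suc n) \<circ> t\<close> is the identity.\<close>

lemma split_at_homotopy:
  assumes "split_at n"
  obtains t where "t \<in> mod_hom ZT (P (Suc n)) (P (Suc (Suc n)))"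
    and "\<And>x. x \<in> carrier (P (Suc (Suc n))) \<Longrightarrow> d (Suc n) (t (d (Suc n) x)) = d (Suc n) x"
proof -
  obtain S where S: "S \<in> mod_hom ZT (P (Suc n)) (P (Suc n))"
    "\<And>x. x \<in> carrier (P (Suc n)) \<Longrightarrow> d n (S x) = d n x"
    "\<And>x. x \<in> carrier (P (Suc (Suc n))) \<Longrightarrow> S (d (Suc n) x) = \<zero>\<^bsub>P (Suc n)\<^esub>"
    using assms unfolding split_at_def by blast
  let ?\<alpha> = "\<lambda>x. x \<ominus>\<^bsub>P (Suc n)\<^esub> S x"
  note Scl = mod_hom_closed[OF S(1)]
  have \<alpha>: "?\<alpha> \<in> mod_hom ZT (P (Suc n)) (P (Suc n))"
  proof (rule mod_homI)
    fix x y assume xy: "x \<in> carrier (P (Suc n))" "y \<in> carrier (P (Suc n))"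
    then show "?\<alpha> x \<in> carrier (P (Suc n))" by (simp add: Scl)
    from xy show "?\<alpha> (x \<oplus>\<^bsub>P (Suc n)\<^esub> y) = ?\<alpha> x \<oplus>\<^bsub>P (Suc n)\<^esub> ?\<alpha> y"
      by (simp add: mod_hom_add[OF S(1)] Scl P.M.minus_eq P.M.minus_add P.M.a_ac)
  next
    fix a x assume "a \<in> carrier ZT" "x \<in> carrier (P (Suc n))"
    then show "?\<alpha> (a \<odot>\<^bsub>P (Suc n)\<^esub> x) = a \<odot>\<^bsub>P (Suc n)\<^esub> ?\<alpha> x"
      by (simp add: mod_hom_smult[OF S(1)] Scl P.smult_r_diff)
  qed
  have "?\<alpha> ` carrier (P (Suc n)) \<subseteq> d (Suc n) ` carrier (P (Suc (Suc n)))"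
    unfolding exact_Suc[symmetric] by (auto simp: d_diff Scl S(2) d_closed P.M.diff_eq_zero_iff)
  with projective P.left_module_axioms P.left_module_axioms d_hom \<alpha>
  obtain t where t: "t \<in> mod_hom ZT (P (Suc n)) (P (Suc (Suc n)))"
    "\<And>x. x \<in> carrier (P (Suc n)) \<Longrightarrow> d (Suc n) (t x) = ?\<alpha> x"
    by (rule projective_module_lift) blast
  show thesis
    by (rule that[OF t(1)]) (simp add: t(2) d_closed S(3) P.M.minus_eq)
qed

text \<open>The new endomorphism is \<open>t \<circ> d (Suc n)\<close>: the homotopy identity is its
  first condition, and \<open>d_d\<close> gives the second.\<close>

lemma split_at_Suc:
  assumes "split_at n"
  shows "split_at (Suc n)"
proof -
  obtain t where t: "t \<in> mod_hom ZT (P (Suc n)) (P (Suc (Suc n)))"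
    "\<And>x. x \<in> carrier (P (Suc (Suc n))) \<Longrightarrow> d (Suc n) (t (d (Suc n) x)) = d (Suc n) x"
    using assms by (rule split_at_homotopy) blast
  have "t (d (Suc n) (d (Suc (Suc n)) x)) = \<zero>\<^bsub>P (Suc (Suc n))\<^esub>"
    if "x \<in> carrier (P (Suc (Suc (Suc n))))" for x
    using that mod_hom_zero[OF P.left_module_axioms P.left_module_axioms t(1)] by (simp add: d_d)
  then show ?thesis
    unfolding split_at_def using mod_hom_comp[OF d_hom t(1)] t(2)
    by (intro bexI[of _ "\<lambda>x. t (d (Suc n) x)"]) simp_all
qed

text \<open>A cocycle \<open>f\<close> kills \<open>x - t (d (Suc n) x)\<close>, which is a cycle
  and hence a boundary. So \<open>f\<close> is the coboundary of \<open>f \<circ> t\<close>. The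
  index shifts by two because \<open>t\<close> ends in \<open>P (Suc (Suc n))\<close>, where
  \<open>f\<close> lives.\<close>

lemma split_at_imp_trivial_cohomology:
  assumes "split_at n" and M: "left_module ZT M"
  shows "trivial_group (Hom_cohomology ZT P d M (Suc (Suc n)))"
proof -
  have "\<exists>g\<in>mod_hom ZT (P (Suc n)) M. \<forall>x\<in>carrier (P (Suc (Suc n))). f x = g (d (Suc n) x)"
    if f: "f \<in> mod_hom ZT (P (Suc (Suc n))) M"
      and f0: "\<forall>x\<in>carrier (P (Suc (Suc (Suc n)))). f (d (Suc (Suc n)) x) = \<zero>\<^bsub>M\<^esub>" for f
  proof -
    interpret M: left_module ZT M by fact
    obtain t where t: "t \<in> mod_hom ZT (P (Suc n)) (P (Suc (Suc n)))"
      "\<And>x. x \<in> carrier (P (Suc (Suc n))) \<Longrightarrow> d (Suc n) (t (d (Suc n) x)) = d (Suc n) x"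
      using assms(1) by (rule split_at_homotopy) blast
    have "f x = f (t (d (Suc n) x))" if x: "x \<in> carrier (P (Suc (Suc n)))" for x
    proof -
      let ?y = "t (d (Suc n) x)"
      have y: "?y \<in> carrier (P (Suc (Suc n)))" using x by (simp add: mod_hom_closed[OF t(1)] d_closed)
      have "d (Suc n) (x \<ominus>\<^bsub>P (Suc (Suc n))\<^esub> ?y) = \<zero>\<^bsub>P (Suc n)\<^esub>"
        using x y by (simp add: d_diff t(2) d_closed P.M.diff_eq_zero_iff)
      then have "x \<ominus>\<^bsub>P (Suc (Suc n))\<^esub> ?y \<in> d (Suc (Suc n)) ` carrier (P (Suc (Suc (Suc n))))"
        using x y exact_Suc[of "Suc n"] by blast
      then have "f (x \<ominus>\<^bsub>P (Suc (Suc n))\<^esub> ?y) = \<zero>\<^bsub>M\<^esub>" using f0 by (elim imageE) simp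
      then show ?thesis
        using x y mod_hom_diff[OF P.left_module_axioms M f] mod_hom_closed[OF f]
        by (simp add: M.M.diff_eq_zero_iff)
    qed
    then show ?thesis
      using mod_hom_comp[OF t(1) f] by (intro bexI[of _ "\<lambda>x. f (t x)"]) simp_all
  qed
  then show ?thesis
    by (subst trivial_Hom_cohomology_Suc_iff)
      (auto intro: P.left_module_axioms M d_hom d_d)
qed

text \<open>If \<open>h\<close> lifts \<open>\<epsilon>\<close> to the monoid ring, then on the kernel of \<open>\<epsilon>\<close> the identity is the sum
  of \<open>y \<mapsto> h y \<odot> p\<close>, which factors through \<open>d 0\<close> by means of the derivation, and of
  \<open>y \<mapsto> y - h y \<odot> p\<close>, which factors through \<open>d 0\<close> because \<open>P 0\<close> is projective.\<close>

lemma split_at_0: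
  assumes p: "p \<in> carrier (P 0)" "\<epsilon> p = 1"
    and D: "\<And>t. t \<in> carrier T \<Longrightarrow> D t \<in> carrier (P (Suc 0))"
    and D_mult: "\<And>s t. \<lbrakk>s \<in> carrier T; t \<in> carrier T\<rbrakk> \<Longrightarrow>
      D (s \<otimes> t) = D s \<oplus>\<^bsub>P (Suc 0)\<^esub> frag_of s \<odot>\<^bsub>P (Suc 0)\<^esub> D t"
    and dD: "\<And>t. t \<in> carrier T \<Longrightarrow> d 0 (D t) = frag_of t \<odot>\<^bsub>P 0\<^esub> p \<ominus>\<^bsub>P 0\<^esub> p"
  shows "split_at 0"
proof -
  let ?P1 = "P (Suc 0)"
  obtain h where h: "h \<in> mod_hom ZT (P 0) (regular_module ZT)"
    and aug_h: "\<And>y. y \<in> carrier (P 0) \<Longrightarrow> augmentation (h y) = \<epsilon> y"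
    by (rule augmentation_lift) blast
  have h_cl: "h y \<in> carrier ZT" if "y \<in> carrier (P 0)" for y
    using mod_hom_closed[OF h that] by (simp add: regular_module_def)
  have h_add: "h (x \<oplus>\<^bsub>P 0\<^esub> y) = h x + h y" if "x \<in> carrier (P 0)" "y \<in> carrier (P 0)" for x y
    using mod_hom_add[OF h that] by (simp add: regular_module_def monoid_ring_simps)
  have h_smult: "h (r \<odot>\<^bsub>P 0\<^esub> y) = r \<otimes>\<^bsub>ZT\<^esub> h y" if "r \<in> carrier ZT" "y \<in> carrier (P 0)" for r y
    using mod_hom_smult[OF h that] by (simp add: regular_module_def)

  have "D \<in> carrier T \<rightarrow> carrier ?P1" using D by blast
  with P.M.abelian_group_axioms obtain K
    where K_of: "\<And>s. s \<in> carrier T \<Longrightarrow> K (frag_of s) = D s"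
    and "\<And>r. Poly_Mapping.keys r \<subseteq> carrier T \<Longrightarrow> K r \<in> carrier ?P1"
    and K_0: "K 0 = \<zero>\<^bsub>?P1\<^esub>"
    and "\<And>r q. \<lbrakk>Poly_Mapping.keys r \<subseteq> carrier T; Poly_Mapping.keys q \<subseteq> carrier T\<rbrakk> \<Longrightarrow>
      K (r + q) = K r \<oplus>\<^bsub>?P1\<^esub> K q"
    and "\<And>r q. \<lbrakk>Poly_Mapping.keys r \<subseteq> carrier T; Poly_Mapping.keys q \<subseteq> carrier T\<rbrakk> \<Longrightarrow>
      K (r - q) = K r \<ominus>\<^bsub>?P1\<^esub> K q"
    by (rule additive_extension) blast
  then have K_cl: "\<And>r. r \<in> carrier ZT \<Longrightarrow> K r \<in> carrier ?P1"
    and K_add: "\<And>r q. \<lbrakk>r \<in> carrier ZT; q \<in> carrier ZT\<rbrakk> \<Longrightarrow> K (r + q) = K r \<oplus>\<^bsub>?P1\<^esub> K q"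
    and K_diff: "\<And>r q. \<lbrakk>r \<in> carrier ZT; q \<in> carrier ZT\<rbrakk> \<Longrightarrow> K (r - q) = K r \<ominus>\<^bsub>?P1\<^esub> K q"
    by (simp_all add: monoid_ring_simps)
  have diff_cl: "r - q \<in> carrier ZT" if "r \<in> carrier ZT" "q \<in> carrier ZT" for r q
    using that keys_diff[of r q] by (auto simp: monoid_ring_simps)
  have cmul_cl: "frag_cmul k r \<in> carrier ZT" if "r \<in> carrier ZT" for k r
    using that keys_cmul[of k r] by (auto simp: monoid_ring_simps)
  have mult_cl: "frag_of s \<otimes>\<^bsub>ZT\<^esub> r \<in> carrier ZT" if "s \<in> carrier T" "r \<in> carrier ZT" for s r
    using that frag_of_ZT by simp

  \<comment> \<open>The extended derivation obeys
    \<open>K (s r) = augmentation r K s + s K r\<close>; the integer multiple is moved inside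
    \<open>K\<close>, where it is formed in the ring. On augmentation zero, \<open>K\<close>
    commutes with the action of \<open>T\<close>.\<close>
  have K_act: "K (frag_of s \<otimes>\<^bsub>ZT\<^esub> r - frag_cmul (augmentation r) (frag_of s)) = frag_of s \<odot>\<^bsub>?P1\<^esub> K r"
    if s: "s \<in> carrier T" and "r \<in> carrier ZT" for s r
  proof -
    have "Poly_Mapping.keys r \<subseteq> carrier T" using that by (simp add: monoid_ring_simps)
    then have "K (frag_of s \<otimes>\<^bsub>ZT\<^esub> r - frag_cmul (augmentation r) (frag_of s)) =
        frag_of s \<odot>\<^bsub>?P1\<^esub> K r \<and> r \<in> carrier ZT"
    proof (induction r rule: frag_induction)
      case zero
      show ?case
        using s frag_of_ZT[OF s]
        by (simp add: K_0 monoid_ring_mult_lin[OF monoid_axioms] P.smult_r_zero monoid_ring_simps)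
    next
      case (one t)
      then show ?case
        using s frag_of_ZT D[OF s] D[OF one] D_mult[OF s one]
          P.lsmult_closed[OF frag_of_ZT[OF s] D[OF one]]
        by (simp add: monoid_ring_mult_lin[OF monoid_axioms] K_diff K_of P.M.minus_eq P.M.a_ac P.M.r_neg)
           (simp add: P.M.a_assoc[symmetric] P.M.r_neg)
    next
      case (diff a b)
      let ?F = "\<lambda>r. frag_of s \<otimes>\<^bsub>ZT\<^esub> r - frag_cmul (augmentation r) (frag_of s)"
      have "?F (a - b) = ?F a - ?F b"
        by (simp add: monoid_ring_mult_lin[OF monoid_axioms] frag_cmul_diff_distrib)
      then show ?case
        using diff s frag_of_ZT[OF s]
        by (simp add: K_diff diff_cl cmul_cl mult_cl K_cl P.smult_r_diff)
    qed
    then show ?thesis ..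
  qed
  \<comment> \<open>The relation \<open>dD\<close> extended additively; for \<open>r\<close> of
    augmentation zero the right side is \<open>r p\<close>.\<close>
  have dK: "d 0 (K r) = (r - frag_cmul (augmentation r) (frag_of \<one>)) \<odot>\<^bsub>P 0\<^esub> p"
    if "r \<in> carrier ZT" for r
  proof -
    have 1: "frag_of \<one> \<in> carrier ZT" by (rule frag_of_ZT) simp
    have smult_diff: "(a - b) \<odot>\<^bsub>P 0\<^esub> p = a \<odot>\<^bsub>P 0\<^esub> p \<ominus>\<^bsub>P 0\<^esub> b \<odot>\<^bsub>P 0\<^esub> p"
      if "a \<in> carrier ZT" "b \<in> carrier ZT" for a b
      using P.smult_l_diff[OF that p(1)] monoid_ring_diff[OF that] by simp
    have one_p: "frag_of \<one> \<odot>\<^bsub>P 0\<^esub> p = p" using P.lsmult_one[OF p(1)] by (simp add: monoid_ring_simps)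
    have "Poly_Mapping.keys r \<subseteq> carrier T" using that by (simp add: monoid_ring_simps)
    then have "d 0 (K r) = (r - frag_cmul (augmentation r) (frag_of \<one>)) \<odot>\<^bsub>P 0\<^esub> p \<and> r \<in> carrier ZT"
    proof (induction r rule: frag_induction)
      case zero
      show ?case
        using mod_hom_zero[OF P.left_module_axioms P.left_module_axioms d_hom[of 0]]
          P.smult_l_zero[OF p(1)]
        by (simp add: K_0 monoid_ring_simps)
    next
      case (one t)
      then show ?case using frag_of_ZT[OF one] 1 by (simp add: K_of dD smult_diff one_p)
    next
      case (diff a b)
      let ?F = "\<lambda>r. r - frag_cmul (augmentation r) (frag_of \<one>)"
      have "?F (a - b) = ?F a - ?F b" by (simp add: frag_cmul_diff_distrib)
      moreover have "d 0 (K (a - b)) = ?F a \<odot>\<^bsub>P 0\<^esub> p \<ominus>\<^bsub>P 0\<^esub> ?F b \<odot>\<^bsub>P 0\<^esub> p"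
        using diff by (simp add: K_diff K_cl d_diff)
      ultimately show ?case
        using diff smult_diff[of "?F a" "?F b"] 1 \<open>?F (a - b) = ?F a - ?F b\<close>
        by (simp only: diff_cl cmul_cl)
    qed
    then show ?thesis ..
  qed

  let ?\<alpha> = "\<lambda>y. y \<ominus>\<^bsub>P 0\<^esub> h y \<odot>\<^bsub>P 0\<^esub> p"
  have hp: "h y \<odot>\<^bsub>P 0\<^esub> p \<in> carrier (P 0)" if "y \<in> carrier (P 0)" for y
    using that p(1) by (simp add: P.lsmult_closed h_cl)
  have \<alpha>: "?\<alpha> \<in> mod_hom ZT (P 0) (P 0)"
  proof (rule mod_homI)
    fix x y assume xy: "x \<in> carrier (P 0)" "y \<in> carrier (P 0)"
    then show "?\<alpha> x \<in> carrier (P 0)" by (simp add: hp)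
    have "(h x + h y) \<odot>\<^bsub>P 0\<^esub> p = h x \<odot>\<^bsub>P 0\<^esub> p \<oplus>\<^bsub>P 0\<^esub> h y \<odot>\<^bsub>P 0\<^esub> p"
      using xy p(1) P.lsmult_l_distr[of "h x" "h y" p] by (simp add: h_cl monoid_ring_simps(2))
    with xy show "?\<alpha> (x \<oplus>\<^bsub>P 0\<^esub> y) = ?\<alpha> x \<oplus>\<^bsub>P 0\<^esub> ?\<alpha> y"
      by (simp add: h_add hp P.M.minus_eq P.M.minus_add P.M.a_ac)
  next
    fix a x assume "a \<in> carrier ZT" "x \<in> carrier (P 0)"
    then show "?\<alpha> (a \<odot>\<^bsub>P 0\<^esub> x) = a \<odot>\<^bsub>P 0\<^esub> ?\<alpha> x"
      using p(1) by (simp add: h_smult h_cl hp P.smult_r_diff P.lsmult_assoc)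
  qed
  \<comment> \<open>As \<open>\<epsilon> p = 1\<close>, the elements \<open>y\<close> and
    \<open>h y p\<close> have the same image under \<open>\<epsilon>\<close>, so
    \<open>?\<alpha> y\<close> lies in its kernel.\<close>
  have "?\<alpha> ` carrier (P 0) \<subseteq> d 0 ` carrier (P (Suc 0))"
    using p by (auto simp: exact_0[symmetric, simplified] \<epsilon>_diff hp \<epsilon>_smult h_cl aug_h)
  with projective P.left_module_axioms P.left_module_axioms d_hom \<alpha>
  obtain l where l: "l \<in> mod_hom ZT (P 0) ?P1"
    and dl: "\<And>y. y \<in> carrier (P 0) \<Longrightarrow> d 0 (l y) = ?\<alpha> y"
    by (rule projective_module_lift) blast
  note l_cl = mod_hom_closed[OF l]

  let ?S = "\<lambda>x. K (h (d 0 x)) \<oplus>\<^bsub>?P1\<^esub> l (d 0 x)"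
  have Kh: "K (h (d 0 x)) \<in> carrier ?P1" if "x \<in> carrier ?P1" for x
    using that by (simp add: K_cl h_cl d_closed)
  have "?S \<in> mod_hom ZT ?P1 ?P1"
  proof (rule mod_hom_monoid_ringI[OF monoid_axioms P.left_module_axioms P.left_module_axioms])
    fix x y assume xy: "x \<in> carrier ?P1" "y \<in> carrier ?P1"
    then show "?S x \<in> carrier ?P1" by (simp add: Kh l_cl d_closed)
    from xy show "?S (x \<oplus>\<^bsub>?P1\<^esub> y) = ?S x \<oplus>\<^bsub>?P1\<^esub> ?S y"
      by (simp add: d_add d_closed h_add K_add h_cl K_cl mod_hom_add[OF l] l_cl P.M.a_ac)
  next
    fix t x assume t: "t \<in> carrier T" and x: "x \<in> carrier ?P1"
    \<comment> \<open>\<open>h (d 0 x)\<close> has augmentation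
      \<open>\<epsilon> (d 0 x) = 0\<close>, so the correction term of \<open>K_act\<close>
      disappears.\<close>
    have "K (frag_of t \<otimes>\<^bsub>ZT\<^esub> h (d 0 x)) = frag_of t \<odot>\<^bsub>?P1\<^esub> K (h (d 0 x))"
      using K_act[OF t h_cl[OF d_closed[OF x]]] x by (simp add: aug_h d_closed \<epsilon>_d)
    then show "?S (frag_of t \<odot>\<^bsub>?P1\<^esub> x) = frag_of t \<odot>\<^bsub>?P1\<^esub> ?S x"
      using x frag_of_ZT[OF t]
      by (simp add: d_smult d_closed h_smult mod_hom_smult[OF l] P.lsmult_r_distr Kh l_cl)
  qed
  moreover have "d 0 (?S x) = d 0 x" if x: "x \<in> carrier ?P1" for x
  proof -
    let ?y = "d 0 x"
    have y: "?y \<in> carrier (P 0)" using x by (rule d_closed)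
    have "d 0 (?S x) = h ?y \<odot>\<^bsub>P 0\<^esub> p \<oplus>\<^bsub>P 0\<^esub> (?y \<ominus>\<^bsub>P 0\<^esub> h ?y \<odot>\<^bsub>P 0\<^esub> p)"
      using x y by (simp add: d_add Kh l_cl dK h_cl dl aug_h \<epsilon>_d)
    then show ?thesis
      using y hp[OF y] by (simp add: P.M.minus_eq P.M.a_lcomm P.M.r_neg)
  qed
  moreover have "?S (d (Suc 0) x) = \<zero>\<^bsub>?P1\<^esub>" if x: "x \<in> carrier (P (Suc (Suc 0)))" for x
  proof -
    have "h \<zero>\<^bsub>P 0\<^esub> = 0"
      using mod_hom_zero[OF P.left_module_axioms P.left_module_regular_module h]
      by (simp add: regular_module_def monoid_ring_simps)
    then show ?thesis
      using x mod_hom_zero[OF P.left_module_axioms P.left_module_axioms l] by (simp add: d_d K_0)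
  qed
  ultimately show ?thesis
    unfolding split_at_def by (intro bexI[of _ ?S]) simp_all
qed

section \<open>A nonzero class in degree one\<close>

text \<open>The additive extension \<open>\<kappa>\<close> of \<open>\<delta>\<close> is invariant
  under \<open>T\<close> on augmentation zero, so \<open>\<kappa> \<circ> h \<circ> d 0\<close> is a
  cocycle with trivial coefficients. If it were \<open>g \<circ> d 0\<close>, then at
  \<open>u p - p\<close> with \<open>\<epsilon> p = 1\<close> the map \<open>g\<close> would give
  zero, the action on the coefficients being trivial, whereas \<open>\<kappa> \<circ> h\<close>
  gives \<open>\<delta> u\<close>.\<close>

lemma nontrivial_cohomology_1:
  fixes \<delta> :: "'a \<Rightarrow> int" and j :: "int \<Rightarrow> 'm"
  assumes \<delta>_mult: "\<And>s t. \<lbrakk>s \<in> carrier T; t \<in> carrier T\<rbrakk> \<Longrightarrow> \<delta> (s \<otimes> t) = \<delta> s + \<delta> t"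
    and u: "u \<in> carrier T" "\<delta> u \<noteq> 0" and j: "inj j"
  shows "\<not> trivial_group (Hom_cohomology ZT P d (trivial_module_on j) (Suc 0))"
proof
  let ?M = "trivial_module_on j :: ('a \<Rightarrow>\<^sub>0 int, 'm) module"
  assume trivial: "trivial_group (Hom_cohomology ZT P d ?M (Suc 0))"
  note M = left_module_trivial_module_on[OF j] and [simp] = trivial_module_on_simps[OF j]
  interpret M: left_module ZT ?M by (rule M)
  obtain h where h: "h \<in> mod_hom ZT (P 0) (regular_module ZT)"
    and aug_h: "\<And>y. y \<in> carrier (P 0) \<Longrightarrow> augmentation (h y) = \<epsilon> y"
    by (rule augmentation_lift) blast
  \<comment> \<open>Each basis element \<open>t\<close> is weighted by \<open>\<delta> t\<close>
    before the coefficients are summed, which makes \<open>\<kappa>\<close> the additive extension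
    of \<open>\<delta>\<close>.\<close>
  define \<kappa> where "\<kappa> r = augmentation (frag_extend (\<lambda>t. frag_cmul (\<delta> t) (frag_of t)) r)" for r
  have \<kappa>: "\<kappa> 0 = 0" "\<kappa> (r + q) = \<kappa> r + \<kappa> q" "\<kappa> (r - q) = \<kappa> r - \<kappa> q" "\<kappa> (frag_of t) = \<delta> t" for r q t
    by (simp_all add: \<kappa>_def frag_extend_add frag_extend_diff)
  have \<kappa>_act: "\<kappa> (frag_of s \<otimes>\<^bsub>ZT\<^esub> r) = \<delta> s * augmentation r + \<kappa> r"
    if s: "s \<in> carrier T" and "r \<in> carrier ZT" for s r
  proof -
    have "Poly_Mapping.keys r \<subseteq> carrier T" using that by (simp add: monoid_ring_simps)
    then show ?thesis
      by (induction r rule: frag_induction)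
        (auto simp: monoid_ring_mult_lin[OF monoid_axioms] \<kappa> \<delta>_mult[OF s] algebra_simps)
  qed
  have h_cl: "h y \<in> carrier ZT" if "y \<in> carrier (P 0)" for y
    using mod_hom_closed[OF h that] by (simp add: regular_module_def)
  have \<kappa>h_act: "\<kappa> (h (frag_of s \<odot>\<^bsub>P 0\<^esub> y)) = \<delta> s * \<epsilon> y + \<kappa> (h y)"
    if "s \<in> carrier T" "y \<in> carrier (P 0)" for s y
    using mod_hom_smult[OF h frag_of_ZT[OF that(1)] that(2)] that
    by (simp add: regular_module_def \<kappa>_act h_cl aug_h)
  have \<kappa>h_add: "\<kappa> (h (x \<oplus>\<^bsub>P 0\<^esub> y)) = \<kappa> (h x) + \<kappa> (h y)"
    if "x \<in> carrier (P 0)" "y \<in> carrier (P 0)" for x y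
    using mod_hom_add[OF h that] by (simp add: regular_module_def \<kappa> monoid_ring_simps)
  have h_0: "h \<zero>\<^bsub>P 0\<^esub> = 0"
    using mod_hom_zero[OF P.left_module_axioms P.left_module_regular_module h]
    by (simp add: regular_module_def monoid_ring_simps)
  let ?f = "\<lambda>x. j (\<kappa> (h (d 0 x)))"
  have f: "?f \<in> mod_hom ZT (P (Suc 0)) ?M"
    by (rule mod_hom_monoid_ringI[OF monoid_axioms P.left_module_axioms M])
      (auto simp: d_add d_closed d_smult frag_of_ZT \<kappa>h_act \<kappa>h_add \<epsilon>_d)
  have f0: "\<forall>x\<in>carrier (P (Suc (Suc 0))). ?f (d (Suc 0) x) = \<zero>\<^bsub>?M\<^esub>"
    by (simp add: d_d h_0 \<kappa>)
  have "\<forall>f\<in>mod_hom ZT (P (Suc 0)) ?M.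
      (\<forall>x\<in>carrier (P (Suc (Suc 0))). f (d (Suc 0) x) = \<zero>\<^bsub>?M\<^esub>) \<longrightarrow>
      (\<exists>g\<in>mod_hom ZT (P 0) ?M. \<forall>x\<in>carrier (P (Suc 0)). f x = g (d 0 x))"
    using trivial P.left_module_axioms M d_hom d_d
    by (subst (asm) trivial_Hom_cohomology_Suc_iff) assumption+
  from mp[OF bspec[OF this f] f0] obtain g where g: "g \<in> mod_hom ZT (P 0) ?M"
    "\<And>x. x \<in> carrier (P (Suc 0)) \<Longrightarrow> ?f x = g (d 0 x)"
    by blast
  obtain p where p: "p \<in> carrier (P 0)" "\<epsilon> p = 1" using \<epsilon>_image by (metis UNIV_I imageE)
  define q where "q = frag_of u \<odot>\<^bsub>P 0\<^esub> p"
  have q: "q \<in> carrier (P 0)" "\<epsilon> q = 1" "\<kappa> (h q) = \<delta> u + \<kappa> (h p)"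
    using p u by (simp_all add: q_def P.lsmult_closed frag_of_ZT \<epsilon>_smult \<kappa>h_act)
  have "g q = g p"
  proof -
    obtain k where k: "g p = j k" using mod_hom_closed[OF g(1) p(1)] by auto
    then show ?thesis using mod_hom_smult[OF g(1) frag_of_ZT[OF u(1)] p(1)] by (simp add: q_def)
  qed
  obtain x where x: "x \<in> carrier (P (Suc 0))" "d 0 x = q \<ominus>\<^bsub>P 0\<^esub> p"
  proof -
    have "q \<ominus>\<^bsub>P 0\<^esub> p \<in> {x \<in> carrier (P 0). \<epsilon> x = 0}" using p q by (simp add: \<epsilon>_diff)
    then show thesis using that by (auto simp: exact_0)
  qed
  have "j (\<kappa> (h (q \<ominus>\<^bsub>P 0\<^esub> p))) = \<zero>\<^bsub>?M\<^esub>"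
    using g(2)[OF x(1)] x(2) mod_hom_diff[OF P.left_module_axioms M g(1) q(1) p(1)] \<open>g q = g p\<close>
      mod_hom_closed[OF g(1) p(1)]
    by (simp del: trivial_module_on_simps add: M.minus_eq M.r_neg)
  then have "\<kappa> (h (q \<ominus>\<^bsub>P 0\<^esub> p)) = 0" using j by (simp add: inj_eq)
  moreover have "\<kappa> (h q) = \<kappa> (h (q \<ominus>\<^bsub>P 0\<^esub> p)) + \<kappa> (h p)"
    using \<kappa>h_add[of "q \<ominus>\<^bsub>P 0\<^esub> p" p] p q by (simp add: P.M.minus_eq P.M.a_assoc P.M.l_neg)
  ultimately show False using q(3) u(2) by simp
qed

end

section \<open>Cohomological dimension of monoids over a free group\<close>

lemma letter_inv_simps [simp]:
  "letter_inv (x, b) = (x, \<not> b)" "letter_inv (letter_inv a) = a" "fst (letter_inv a) = fst a"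
  by (simp_all add: letter_inv_def)

lemma content_simps [simp]:
  "content [] = {}" "content (a # w) = insert (fst a) (content w)"
  "content (v @ w) = content v \<union> content w"
  by (auto simp: content_def)

lemma content_cons_cancel: "content (cons_cancel a w) \<subseteq> insert (fst a) (content w)"
  by (cases w) auto

lemma content_foldr_cons_cancel: "content (foldr cons_cancel v w) \<subseteq> content v \<union> content w"
  by (induction v) (use content_cons_cancel in fastforce)+

text \<open>On the free group this is the homomorphism to the integers taking every letter of
  \<open>X\<close> to 1; it provides \<open>\<delta>\<close> in degree one.\<close>

definition exponent_sum :: "'x word \<Rightarrow> int"
  where "exponent_sum w = (\<Sum>a\<leftarrow>w. if snd a then 1 else - 1)"

text \<open>A cancelling pair contributes \<open>1 - 1\<close>, so \<open>cons_cancel\<close> shifts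
  the sum by the sign of its letter whether or not it cancels.\<close>

lemma exponent_sum_reduce_word:
  fixes v w :: "'x word"
  shows "exponent_sum (reduce_word (v @ w)) = exponent_sum v + exponent_sum w"
proof -
  have [simp]: "exponent_sum [] = 0" "exponent_sum (a # w) = (if snd a then 1 else - 1) + exponent_sum w"
    for a :: "'x \<times> bool" and w by (simp_all add: exponent_sum_def)
  have "exponent_sum (cons_cancel a w) = (if snd a then 1 else - 1) + exponent_sum w"
    for a :: "'x \<times> bool" and w by (cases w) (auto simp: letter_inv_def)
  then have "exponent_sum (foldr cons_cancel v w) = exponent_sum v + exponent_sum w" for v w :: "'x word"
    by (induction v) simp_all
  from this[of v "foldr cons_cancel w []"] this[of w "[]"] show ?thesis
    by (simp add: reduce_word_def)
qed

text \<open>The idempotent \<open>e\<close> need not be central: it suffices that right multiplication by \<open>e\<close> factors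
  through the homomorphism \<open>\<pi>\<close> to the free group, whose letters are represented by \<open>g\<close>.\<close>

locale monoid_over_free_group = monoid T for T :: "('a, 'b) monoid_scheme" (structure) +
  fixes X :: "'x set" and \<pi> :: "'a \<Rightarrow> 'x word" and g :: "'x \<times> bool \<Rightarrow> 'a" and e :: 'a
  assumes e_closed: "e \<in> carrier T"
    and e_idem: "e \<otimes> e = e"
    and g_closed: "fst a \<in> X \<Longrightarrow> g a \<in> carrier T"
    and e_g: "fst a \<in> X \<Longrightarrow> e \<otimes> g a = g a"
    and g_inv: "fst a \<in> X \<Longrightarrow> g a \<otimes> g (letter_inv a) = e"
    and \<pi>_hom: "\<pi> \<in> hom T (free_group X)"
    and \<pi>_g: "x \<in> X \<Longrightarrow> \<pi> (g (x, True)) = [(x, True)]"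
    and mult_e: "t \<in> carrier T \<Longrightarrow> t \<otimes> e = foldr (\<lambda>a s. g a \<otimes> s) (\<pi> t) e"
begin

text \<open>Evaluation starts from \<open>e\<close>, a left unit for the letters \<open>g a\<close>,
  so that \<open>mult_e\<close> reads \<open>t \<otimes> e = eval_word (\<pi> t)\<close>.\<close>

definition eval_word :: "'x word \<Rightarrow> 'a"
  where "eval_word w = foldr (\<lambda>a s. g a \<otimes> s) w e"

lemma eval_word_simps [simp]: "eval_word [] = e" "eval_word (a # w) = g a \<otimes> eval_word w"
  by (simp_all add: eval_word_def)

lemma eval_word_closed: "content w \<subseteq> X \<Longrightarrow> eval_word w \<in> carrier T"
  by (induction w) (simp_all add: e_closed g_closed)

lemma \<pi>_content: "t \<in> carrier T \<Longrightarrow> content (\<pi> t) \<subseteq> X"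
  using \<pi>_hom by (auto simp: hom_def free_group_def)

lemma \<pi>_mult: "s \<in> carrier T \<Longrightarrow> t \<in> carrier T \<Longrightarrow> \<pi> (s \<otimes> t) = reduce_word (\<pi> s @ \<pi> t)"
  using \<pi>_hom by (simp add: hom_def free_group_def)

text \<open>Fox calculus: a derivation is determined by its values on the generators.\<close>

lemma derivation_lift:
  assumes A: "left_module (monoid_ring T) A" and B: "left_module (monoid_ring T) B"
    and d: "d \<in> mod_hom (monoid_ring T) A B"
    and p: "p \<in> carrier B" "frag_of e \<odot>\<^bsub>B\<^esub> p = p"
    and lift: "\<And>t. t \<in> carrier T \<Longrightarrow> frag_of t \<odot>\<^bsub>B\<^esub> p \<ominus>\<^bsub>B\<^esub> p \<in> d ` carrier A"
  obtains D where "\<And>t. t \<in> carrier T \<Longrightarrow> D t \<in> carrier A"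
    and "\<And>s t. \<lbrakk>s \<in> carrier T; t \<in> carrier T\<rbrakk> \<Longrightarrow>
      D (s \<otimes> t) = D s \<oplus>\<^bsub>A\<^esub> frag_of s \<odot>\<^bsub>A\<^esub> D t"
    and "\<And>t. t \<in> carrier T \<Longrightarrow> d (D t) = frag_of t \<odot>\<^bsub>B\<^esub> p \<ominus>\<^bsub>B\<^esub> p"
proof -
  interpret A: left_module "monoid_ring T" A by fact
  interpret B: left_module "monoid_ring T" B by fact
  interpret d: abelian_group_hom A B d by (rule mod_hom_abelian_group_hom[OF A B d])
  have ZT: "frag_of t \<in> carrier (monoid_ring T)" if "t \<in> carrier T" for t
    using that by (simp add: monoid_ring_simps)
  have act_cl: "frag_of t \<odot>\<^bsub>A\<^esub> y \<in> carrier A" if "t \<in> carrier T" "y \<in> carrier A" for t y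
    using that by (simp add: A.lsmult_closed ZT)
  have actB_cl: "frag_of t \<odot>\<^bsub>B\<^esub> y \<in> carrier B" if "t \<in> carrier T" "y \<in> carrier B" for t y
    using that by (simp add: B.lsmult_closed ZT)
  have act_act: "frag_of s \<odot>\<^bsub>A\<^esub> (frag_of t \<odot>\<^bsub>A\<^esub> y) = frag_of (s \<otimes> t) \<odot>\<^bsub>A\<^esub> y"
    if "s \<in> carrier T" "t \<in> carrier T" "y \<in> carrier A" for s t y
    using A.lsmult_assoc[OF ZT[OF that(1)] ZT[OF that(2)] that(3)]
    by (simp add: monoid_ring_mult_lin[OF monoid_axioms])
  have actB_act: "frag_of s \<odot>\<^bsub>B\<^esub> (frag_of t \<odot>\<^bsub>B\<^esub> y) = frag_of (s \<otimes> t) \<odot>\<^bsub>B\<^esub> y"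
    if "s \<in> carrier T" "t \<in> carrier T" "y \<in> carrier B" for s t y
    using B.lsmult_assoc[OF ZT[OF that(1)] ZT[OF that(2)] that(3)]
    by (simp add: monoid_ring_mult_lin[OF monoid_axioms])
  have d_act: "d (frag_of t \<odot>\<^bsub>A\<^esub> y) = frag_of t \<odot>\<^bsub>B\<^esub> d y" if "t \<in> carrier T" "y \<in> carrier A" for t y
    using that by (simp add: mod_hom_smult[OF d] ZT)

  \<comment> \<open>A lift \<open>c\<close> may be replaced by \<open>e c\<close>, because
    \<open>e\<close> fixes both \<open>g (x, True) p\<close> and \<open>p\<close>. Values fixed by
    \<open>e\<close> are needed since inverse letters multiply to \<open>e\<close>, which need not
    be the unit.\<close>
  have "\<exists>c\<in>carrier A. frag_of e \<odot>\<^bsub>A\<^esub> c = c \<and> d c = frag_of (g (x, True)) \<odot>\<^bsub>B\<^esub> p \<ominus>\<^bsub>B\<^esub> p"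
    if x: "x \<in> X" for x
  proof -
    let ?u = "g (x, True)"
    have u: "?u \<in> carrier T" using x by (simp add: g_closed)
    obtain c where c: "c \<in> carrier A" "d c = frag_of ?u \<odot>\<^bsub>B\<^esub> p \<ominus>\<^bsub>B\<^esub> p"
      using lift[OF u] by (metis imageE)
    have "d (frag_of e \<odot>\<^bsub>A\<^esub> c) = frag_of ?u \<odot>\<^bsub>B\<^esub> p \<ominus>\<^bsub>B\<^esub> p"
      using c u p x
      by (simp add: d_act e_closed B.smult_r_diff ZT actB_cl actB_act e_g)
    moreover have "frag_of e \<odot>\<^bsub>A\<^esub> (frag_of e \<odot>\<^bsub>A\<^esub> c) = frag_of e \<odot>\<^bsub>A\<^esub> c"
      using c by (simp add: act_act e_closed e_idem)
    ultimately show ?thesis using c(1) act_cl[OF e_closed] by blast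
  qed
  then obtain c where c: "\<And>x. x \<in> X \<Longrightarrow> c x \<in> carrier A"
    "\<And>x. x \<in> X \<Longrightarrow> frag_of e \<odot>\<^bsub>A\<^esub> c x = c x"
    "\<And>x. x \<in> X \<Longrightarrow> d (c x) = frag_of (g (x, True)) \<odot>\<^bsub>B\<^esub> p \<ominus>\<^bsub>B\<^esub> p"
    by metis
  \<comment> \<open>With \<open>g' = g (x, False)\<close>, the value on an inverse letter is forced
    by \<open>0 = D (g' g) = D g' + g' D g\<close>.\<close>
  define L where "L a = (if snd a then c (fst a)
      else \<ominus>\<^bsub>A\<^esub> (frag_of (g (fst a, False)) \<odot>\<^bsub>A\<^esub> c (fst a)))" for a
  \<comment> \<open>Fox's formula: the value on \<open>a1 ... an\<close> is the sum of the terms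
    \<open>g a1 ... g a(i-1) L ai\<close>.\<close>
  define F where "F w = foldr (\<lambda>a y. L a \<oplus>\<^bsub>A\<^esub> frag_of (g a) \<odot>\<^bsub>A\<^esub> y) w \<zero>\<^bsub>A\<^esub>" for w
  have F_simps [simp]: "F [] = \<zero>\<^bsub>A\<^esub>" "F (a # w) = L a \<oplus>\<^bsub>A\<^esub> frag_of (g a) \<odot>\<^bsub>A\<^esub> F w" for a w
    by (simp_all add: F_def)
  have L_cl: "L a \<in> carrier A" if "fst a \<in> X" for a
    using that by (auto simp: L_def c g_closed act_cl)
  have L_e: "frag_of e \<odot>\<^bsub>A\<^esub> L a = L a" if "fst a \<in> X" for a
    using that by (auto simp: L_def c g_closed act_cl A.smult_r_minus ZT e_closed act_act e_g)
  have L_inv: "L a \<oplus>\<^bsub>A\<^esub> frag_of (g a) \<odot>\<^bsub>A\<^esub> L (letter_inv a) = \<zero>\<^bsub>A\<^esub>" if "fst a \<in> X" for a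
  proof (cases a)
    case (Pair x b)
    then have x: "x \<in> X" using that by simp
    then show ?thesis
      using Pair g_inv[of "(x, True)"] g_closed[of "(x, True)"] g_closed[of "(x, False)"] c[OF x]
      by (cases b) (simp_all add: L_def A.smult_r_minus ZT act_act act_cl A.M.r_neg A.M.l_neg)
  qed
  have d_L: "d (L a) = frag_of (g a) \<odot>\<^bsub>B\<^esub> p \<ominus>\<^bsub>B\<^esub> p" if "fst a \<in> X" for a
  proof (cases a)
    case (Pair x b)
    then have x: "x \<in> X" using that by simp
    then show ?thesis
      using Pair g_inv[of "(x, False)"] g_closed[of "(x, True)"] g_closed[of "(x, False)"] c[OF x] p
      by (cases b)
        (simp_all add: L_def d_act act_cl actB_cl actB_act B.smult_r_diff ZT,
          simp add: B.M.minus_eq B.M.minus_add B.M.a_comm actB_cl)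
  qed
  have F_cl: "F w \<in> carrier A" if "content w \<subseteq> X" for w
    using that by (induction w) (simp_all add: L_cl g_closed act_cl)
  have F_e: "frag_of e \<odot>\<^bsub>A\<^esub> F w = F w" if "content w \<subseteq> X" for w
  proof (cases w)
    case (Cons a v)
    then show ?thesis
      using that by (simp add: L_cl g_closed act_cl F_cl A.lsmult_r_distr ZT e_closed L_e act_act e_g)
  qed (simp add: A.smult_r_zero ZT e_closed)
  \<comment> \<open>The recursion for \<open>F\<close> survives cancellation: a cancelling pair
    contributes zero by \<open>L_inv\<close> and then acts as \<open>e\<close>, which fixes the
    values of \<open>F\<close>.\<close>
  have F_cancel: "F (cons_cancel a w) = L a \<oplus>\<^bsub>A\<^esub> frag_of (g a) \<odot>\<^bsub>A\<^esub> F w"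
    if "fst a \<in> X" "content w \<subseteq> X" for a w
  proof (cases "\<exists>v. w = letter_inv a # v")
    case True
    then obtain v where w: "w = letter_inv a # v" by blast
    have a': "fst (letter_inv a) \<in> X" and v: "content v \<subseteq> X" using that w by simp_all
    have "L a \<oplus>\<^bsub>A\<^esub> frag_of (g a) \<odot>\<^bsub>A\<^esub> F w =
        (L a \<oplus>\<^bsub>A\<^esub> frag_of (g a) \<odot>\<^bsub>A\<^esub> L (letter_inv a)) \<oplus>\<^bsub>A\<^esub> frag_of e \<odot>\<^bsub>A\<^esub> F v"
      using that(1) a' v
      by (simp add: w A.lsmult_r_distr ZT g_closed L_cl F_cl act_cl act_act g_inv e_closed A.M.a_assoc)
    also have "\<dots> = F v" using that(1) v by (simp add: L_inv F_e F_cl)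
    finally show ?thesis by (simp add: w)
  next
    case False
    then have "cons_cancel a w = a # w" by (cases w) auto
    then show ?thesis by simp
  qed
  have F_foldr: "F (foldr cons_cancel v w) = F v \<oplus>\<^bsub>A\<^esub> frag_of (eval_word v) \<odot>\<^bsub>A\<^esub> F w"
    if "content v \<subseteq> X" "content w \<subseteq> X" for v w
    using that(1)
  proof (induction v)
    case Nil
    show ?case using that(2) by (simp add: F_e F_cl)
  next
    case (Cons a v)
    then have "content (foldr cons_cancel v w) \<subseteq> X"
      using content_foldr_cons_cancel[of v w] that(2) by auto
    with Cons that(2) show ?case
      by (simp add: F_cancel A.lsmult_r_distr ZT g_closed L_cl F_cl act_cl act_act eval_word_closed
          A.M.a_assoc)
  qed
  have F_reduce: "F (reduce_word (v @ w)) = F v \<oplus>\<^bsub>A\<^esub> frag_of (eval_word v) \<odot>\<^bsub>A\<^esub> F w"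
    if "content v \<subseteq> X" "content w \<subseteq> X" for v w
  proof -
    have "F (foldr cons_cancel w []) = F w"
      using F_foldr[of w "[]"] that(2)
      by (simp add: A.smult_r_zero ZT eval_word_closed F_cl)
    moreover have "content (foldr cons_cancel w []) \<subseteq> X"
      using content_foldr_cons_cancel[of w "[]"] that(2) by auto
    ultimately show ?thesis using F_foldr that(1) by (simp add: reduce_word_def)
  qed
  \<comment> \<open>Applying \<open>d\<close> to Fox's formula gives a telescoping sum.\<close>
  have d_F: "d (F w) = frag_of (eval_word w) \<odot>\<^bsub>B\<^esub> p \<ominus>\<^bsub>B\<^esub> p" if "content w \<subseteq> X" for w
    using that
  proof (induction w)
    case Nil
    show ?case using p by (simp add: B.M.minus_eq B.M.r_neg)
  next
    case (Cons a w)
    then have a: "fst a \<in> X" and w: "content w \<subseteq> X" by simp_all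
    have "d (F (a # w)) = (frag_of (g a) \<odot>\<^bsub>B\<^esub> p \<ominus>\<^bsub>B\<^esub> p) \<oplus>\<^bsub>B\<^esub>
        (frag_of (g a \<otimes> eval_word w) \<odot>\<^bsub>B\<^esub> p \<ominus>\<^bsub>B\<^esub> frag_of (g a) \<odot>\<^bsub>B\<^esub> p)"
      using a w p Cons.IH[OF w]
      by (simp add: L_cl F_cl act_cl g_closed d_act d_L B.smult_r_diff ZT actB_cl actB_act
          eval_word_closed)
    then show ?case
      using a w p
      by (simp add: B.M.minus_eq actB_cl g_closed eval_word_closed B.M.a_ac B.M.r_neg2)
  qed
  \<comment> \<open>\<open>t\<close> and \<open>t \<otimes> e\<close> act alike on \<open>p\<close>
    and on the values of \<open>F\<close>, all fixed by \<open>e\<close>; there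
    \<open>eval_word (\<pi> t)\<close> may stand for \<open>t\<close>.\<close>
  have t_e: "frag_of (eval_word (\<pi> t)) = frag_of (t \<otimes> e)" if "t \<in> carrier T" for t
    using mult_e[OF that] by (simp add: eval_word_def)
  show thesis
  proof
    show "F (\<pi> t) \<in> carrier A" if "t \<in> carrier T" for t
      using that by (simp add: F_cl \<pi>_content)
    show "F (\<pi> (s \<otimes> t)) = F (\<pi> s) \<oplus>\<^bsub>A\<^esub> frag_of s \<odot>\<^bsub>A\<^esub> F (\<pi> t)"
      if "s \<in> carrier T" "t \<in> carrier T" for s t
      using that
      by (simp add: \<pi>_mult F_reduce \<pi>_content t_e act_act[symmetric] e_closed F_cl F_e)
    show "d (F (\<pi> t)) = frag_of t \<odot>\<^bsub>B\<^esub> p \<ominus>\<^bsub>B\<^esub> p" if "t \<in> carrier T" for t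
      using that p by (simp add: d_F \<pi>_content t_e actB_act[symmetric] e_closed)
  qed
qed

lemma split_at_0_over_free_group:
  assumes "trivial_resolution T P d \<epsilon>"
  shows "trivial_resolution.split_at T P d 0"
proof -
  interpret trivial_resolution T P d \<epsilon> by fact
  have e: "frag_of e \<in> carrier ZT" by (rule frag_of_ZT[OF e_closed])
  obtain p0 where p0: "p0 \<in> carrier (P 0)" "\<epsilon> p0 = 1" using \<epsilon>_image by (metis UNIV_I imageE)
  \<comment> \<open>\<open>frag_of e\<close> has augmentation 1, so \<open>\<epsilon> p\<close> is
    still 1, and idempotence makes \<open>p\<close> fixed by \<open>e\<close>.\<close>
  define p where "p = frag_of e \<odot>\<^bsub>P 0\<^esub> p0"
  have p: "p \<in> carrier (P 0)" "\<epsilon> p = 1"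
    using p0 e by (simp_all add: p_def P.lsmult_closed \<epsilon>_smult)
  have e_p: "frag_of e \<odot>\<^bsub>P 0\<^esub> p = p"
    using P.lsmult_assoc[OF e e p0(1)]
    by (simp add: p_def monoid_ring_mult_lin[OF monoid_axioms] e_idem)
  have lift: "frag_of t \<odot>\<^bsub>P 0\<^esub> p \<ominus>\<^bsub>P 0\<^esub> p \<in> d 0 ` carrier (P (Suc 0))" if "t \<in> carrier T" for t
    using p frag_of_ZT[OF that]
    by (simp add: exact_0[symmetric, simplified] P.lsmult_closed \<epsilon>_diff \<epsilon>_smult)
  show ?thesis
  proof (rule derivation_lift[OF P.left_module_axioms P.left_module_axioms d_hom p(1) e_p lift])
    fix D
    assume D: "\<And>t. t \<in> carrier T \<Longrightarrow> D t \<in> carrier (P (Suc 0))"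
      and D_mult: "\<And>s t. \<lbrakk>s \<in> carrier T; t \<in> carrier T\<rbrakk> \<Longrightarrow>
        D (s \<otimes> t) = D s \<oplus>\<^bsub>P (Suc 0)\<^esub> frag_of s \<odot>\<^bsub>P (Suc 0)\<^esub> D t"
      and dD: "\<And>t. t \<in> carrier T \<Longrightarrow> d 0 (D t) = frag_of t \<odot>\<^bsub>P 0\<^esub> p \<ominus>\<^bsub>P 0\<^esub> p"
    show ?thesis by (rule split_at_0[where p = p and D = D]) (fact p D D_mult dD)+
  qed
qed

theorem cohomological_dimension_eq_1:
  assumes "X \<noteq> {}" and "infinite (UNIV :: 'm set)"
  shows "cohomological_dimension TYPE('m) T = 1"
proof -
  \<comment> \<open>This is the very selection made inside \<open>Ext\<close>; the bar resolution
    guarantees that it yields a resolution.\<close>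
  define R where "R = (SOME (P :: nat \<Rightarrow> ('a \<Rightarrow>\<^sub>0 int, 'a list \<Rightarrow>\<^sub>0 int) module, d, \<epsilon>).
    projective_resolution (monoid_ring T) trivial_module P d \<epsilon>)"
  obtain P d \<epsilon> where R: "R = (P, d, \<epsilon>)" by (cases R)
  have "\<exists>R. case R of (P :: nat \<Rightarrow> ('a \<Rightarrow>\<^sub>0 int, 'a list \<Rightarrow>\<^sub>0 int) module, d, \<epsilon>) \<Rightarrow>
      projective_resolution (monoid_ring T) trivial_module P d \<epsilon>"
    using trivial_module_has_resolution[OF monoid_axioms] by auto
  then have "case R of (P, d, \<epsilon>) \<Rightarrow> projective_resolution (monoid_ring T) trivial_module P d \<epsilon>"
    unfolding R_def by (rule someI_ex)
  then have res: "projective_resolution (monoid_ring T) trivial_module P d \<epsilon>" by (simp add: R)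
  have H: "monoid_cohomology T M n = Hom_cohomology (monoid_ring T) P d M n"
    for M :: "('a \<Rightarrow>\<^sub>0 int, 'm) module" and n
    using R by (simp add: monoid_cohomology_def Ext_def R_def)
  interpret trivial_resolution T P d \<epsilon> by unfold_locales (rule res)
  have split: "split_at n" for n
    by (induction n) (simp_all add: split_at_Suc split_at_0_over_free_group[OF trivial_resolution_axioms])
  let ?vanishes = "\<lambda>n. \<forall>m>n. \<forall>M :: ('a \<Rightarrow>\<^sub>0 int, 'm) module.
    left_module (monoid_ring T) M \<longrightarrow> trivial_group (monoid_cohomology T M m)"
  have "?vanishes 1"
  proof (intro allI impI)
    fix m :: nat and M :: "('a \<Rightarrow>\<^sub>0 int, 'm) module"
    assume "1 < m" and M: "left_module (monoid_ring T) M"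
    then have "m = Suc (Suc (m - 2))" by simp
    then show "trivial_group (monoid_cohomology T M m)"
      using split_at_imp_trivial_cohomology[OF split M, of "m - 2"] by (simp only: H)
  qed
  moreover have "\<not> ?vanishes 0"
  proof -
    \<comment> \<open>An infinite type contains a copy of the natural numbers and thus, through
      \<open>to_nat\<close>, of the integers.\<close>
    obtain i :: "nat \<Rightarrow> 'm" where i: "inj i" using assms(2) by (auto simp: infinite_iff_countable_subset)
    have j: "inj (i \<circ> to_nat :: int \<Rightarrow> 'm)" using i by (intro inj_compose) simp_all
    obtain x where x: "x \<in> X" using assms(1) by blast
    have "\<not> trivial_group (Hom_cohomology ZT P d (trivial_module_on (i \<circ> to_nat)) (Suc 0))"
    proof (rule nontrivial_cohomology_1)
      show "exponent_sum (\<pi> (s \<otimes> t)) = exponent_sum (\<pi> s) + exponent_sum (\<pi> t)"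
        if "s \<in> carrier T" "t \<in> carrier T" for s t
        using that by (simp add: \<pi>_mult exponent_sum_reduce_word)
      show "g (x, True) \<in> carrier T" using x by (simp add: g_closed)
      show "exponent_sum (\<pi> (g (x, True))) \<noteq> 0" using x by (simp add: \<pi>_g exponent_sum_def)
    qed (rule j)
    then show ?thesis
      using left_module_trivial_module_on[OF j] by (auto simp: H)
  qed
  \<comment> \<open>Vanishing above \<open>n\<close> passes to larger \<open>n\<close>, so success
    at 1 and failure at 0 determine the whole set.\<close>
  ultimately have "{enat n | n. ?vanishes n} = {enat n | n. 1 \<le> n}"
    by (auto simp: Suc_le_eq intro: gr0I)
  also have "Inf \<dots> = 1"
    by (rule antisym) (auto intro!: Inf_lower Inf_greatest simp: one_enat_def)
  finally show ?thesis by (simp add: cohomological_dimension_def)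
qed

end

section \<open>Free Clifford monoids\<close>

lemma reduced_word_Cons:
  "reduced_word (a # w) \<longleftrightarrow> reduced_word w \<and> (\<forall>b v. w = b # v \<longrightarrow> b \<noteq> letter_inv a)"
  by (cases w) (auto simp: reduced_word_def)

lemma cons_cancel_reduced: "reduced_word (a # w) \<Longrightarrow> cons_cancel a w = a # w"
  by (cases w) (auto simp: reduced_word_Cons)

lemma reduced_word_cons_cancel: "reduced_word w \<Longrightarrow> reduced_word (cons_cancel a w)"
  by (cases w) (auto simp: reduced_word_Cons)

lemma reduced_word_foldr: "reduced_word w \<Longrightarrow> reduced_word (foldr cons_cancel v w)"
  by (induction v) (simp_all add: reduced_word_cons_cancel)

lemma reduce_word_reduced: "reduced_word w \<Longrightarrow> reduce_word w = w"
  unfolding reduce_word_def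
  by (induction w) (simp_all add: reduced_word_Cons[of _ "_ :: 'a word"] cons_cancel_reduced)

text \<open>Each letter permutes the reduced words, as in van der Waerden's construction of the free
  group. Reducedness matters when \<open>w\<close> starts with \<open>a\<close>: its tail cannot
  start with \<open>letter_inv a\<close>, so \<open>a\<close> is put back without
  cancelling.\<close>

lemma cons_cancel_letter_inv: "reduced_word w \<Longrightarrow> cons_cancel a (cons_cancel (letter_inv a) w) = w"
proof (cases w)
  case (Cons b v)
  moreover assume "reduced_word w"
  ultimately show ?thesis by (cases v) (auto simp: reduced_word_Cons)
qed simp

lemma foldr_cons_cancel:
  assumes "reduced_word w"
  shows "foldr cons_cancel (cons_cancel a v) w = cons_cancel a (foldr cons_cancel v w)"
proof (cases "\<exists>v'. v = letter_inv a # v'")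
  case True
  then show ?thesis using assms by (auto simp: cons_cancel_letter_inv reduced_word_foldr)
next
  case False
  then have "cons_cancel a v = a # v" by (cases v) auto
  then show ?thesis by simp
qed

text \<open>A word and its reduced form act by the same permutation. Associativity then follows
  without a confluence argument.\<close>

lemma foldr_reduce_word:
  assumes "reduced_word w"
  shows "foldr cons_cancel (reduce_word v) w = foldr cons_cancel v w"
  unfolding reduce_word_def using assms by (induction v) (simp_all add: foldr_cons_cancel)

lemma reduced_word_Nil [simp]: "reduced_word []"
  by (simp add: reduced_word_def)

lemma reduced_word_reduce_word: "reduced_word (reduce_word w)"
  by (simp add: reduce_word_def reduced_word_foldr)

lemma content_reduce_word: "content (reduce_word w) \<subseteq> content w"
  using content_foldr_cons_cancel[of w "[]"] by (simp add: reduce_word_def)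

text \<open>Both sides are the result of letting \<open>u @ v\<close> act on
  \<open>reduce_word w\<close>.\<close>

lemma reduce_word_append_assoc:
  "reduce_word (reduce_word (u @ v) @ w) = reduce_word (u @ reduce_word (v @ w))"
proof -
  have "reduce_word (reduce_word (u @ v) @ w) = foldr cons_cancel (u @ v) (reduce_word w)"
    using foldr_reduce_word[OF reduced_word_reduce_word, of "u @ v" w] by (simp add: reduce_word_def)
  moreover have "reduce_word (u @ reduce_word (v @ w)) =
      foldr cons_cancel u (reduce_word (reduce_word (v @ w)))"
    by (simp add: reduce_word_def)
  ultimately show ?thesis
    by (simp add: reduce_word_reduced[OF reduced_word_reduce_word]) (simp add: reduce_word_def)
qed

lemma free_Clifford_monoid_simps:
  "(u, A) \<in> carrier (free_Clifford_monoid X) \<longleftrightarrow> reduced_word u \<and> content u \<subseteq> A \<and> A \<subseteq> X"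
  "(v, B) \<otimes>\<^bsub>free_Clifford_monoid X\<^esub> (u, A) = (reduce_word (v @ u), B \<union> A)"
  "\<one>\<^bsub>free_Clifford_monoid X\<^esub> = ([], {})"
  by (auto simp: free_Clifford_monoid_def free_group_def)

lemma monoid_free_Clifford_monoid: "monoid (free_Clifford_monoid X)"
proof (rule monoidI)
  fix s t assume "s \<in> carrier (free_Clifford_monoid X)" "t \<in> carrier (free_Clifford_monoid X)"
  then show "s \<otimes>\<^bsub>free_Clifford_monoid X\<^esub> t \<in> carrier (free_Clifford_monoid X)"
    using content_reduce_word[of "fst s @ fst t"]
    by (cases s; cases t) (auto simp: free_Clifford_monoid_simps reduced_word_reduce_word)
  fix r assume "r \<in> carrier (free_Clifford_monoid X)"
  show "s \<otimes>\<^bsub>free_Clifford_monoid X\<^esub> t \<otimes>\<^bsub>free_Clifford_monoid X\<^esub> r =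
      s \<otimes>\<^bsub>free_Clifford_monoid X\<^esub> (t \<otimes>\<^bsub>free_Clifford_monoid X\<^esub> r)"
    by (cases s; cases t; cases r)
      (auto simp: free_Clifford_monoid_simps reduce_word_append_assoc)
qed (auto simp: free_Clifford_monoid_simps reduce_word_reduced)

text \<open>Multiplying \<open>(u, A)\<close> by \<open>([], X)\<close> gives \<open>(u, X)\<close>,
  since \<open>A\<close> is a subset of \<open>X\<close>; only the word survives, and it is the
  product of its letters.\<close>

lemma free_Clifford_monoid_over_free_group:
  "monoid_over_free_group (free_Clifford_monoid X) X fst (\<lambda>a. ([a], X)) ([], X)"
proof -
  let ?C = "free_Clifford_monoid X"
  interpret monoid ?C by (rule monoid_free_Clifford_monoid)
  have eval: "foldr (\<lambda>a s. ([a], X) \<otimes>\<^bsub>?C\<^esub> s) u ([], X) = (u, X)" if "reduced_word u" for u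
    using that
  proof (induction u)
    case (Cons a u)
    then have "reduced_word u" by (simp add: reduced_word_Cons)
    with Cons show ?case
      using reduce_word_reduced[OF Cons.prems] by (simp add: free_Clifford_monoid_simps)
  qed simp
  show ?thesis
  proof
    fix t assume "t \<in> carrier ?C"
    then show "t \<otimes>\<^bsub>?C\<^esub> ([], X) = foldr (\<lambda>a s. ([a], X) \<otimes>\<^bsub>?C\<^esub> s) (fst t) ([], X)"
      by (cases t) (auto simp: free_Clifford_monoid_simps eval reduce_word_reduced)
  qed (auto simp: free_Clifford_monoid_simps reduced_word_def reduce_word_def hom_def free_group_def
      free_Clifford_monoid_def)
qed

section \<open>The maximum group image\<close>

text \<open>For \<open>u\<close> in the free group this is the class of all elements with word
  \<open>u\<close>. Indexing the classes by words exhibits the quotient as a copy of the free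
  group.\<close>

definition sigma_class :: "'x set \<Rightarrow> 'x word \<Rightarrow> ('x word \<times> 'x set) set"
  where "sigma_class X u = {(v, A). v = u \<and> content u \<subseteq> A \<and> A \<subseteq> X}"

text \<open>An idempotent \<open>u\<close> of the free group takes both \<open>u\<close> and
  \<open>[]\<close> to \<open>u\<close> when acting on reduced words; this action is injective, the
  inverse word undoing it.\<close>

lemma idempotents_free_Clifford_monoid:
  "idempotents (free_Clifford_monoid X) = {[]} \<times> Pow X"
proof -
  have "u = []" if u: "reduced_word u" and uu: "reduce_word (u @ u) = u" for u :: "'x word"
  proof -
    have "foldr cons_cancel (map letter_inv (rev u)) (foldr cons_cancel u w) = w"
      if "reduced_word w" for w u
    proof (induction u)
      case (Cons a u)
      then show ?case
        using cons_cancel_letter_inv[of "foldr cons_cancel u w" "letter_inv a"] that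
        by (simp add: reduced_word_foldr)
    qed simp
    note inv = this
    have "reduce_word (u @ u) = foldr cons_cancel u u"
      using reduce_word_reduced[OF u] by (simp add: reduce_word_def)
    then have "foldr cons_cancel u u = foldr cons_cancel u []"
      using uu reduce_word_reduced[OF u] by (simp add: reduce_word_def)
    then show "u = []" using inv[OF u, of u] inv[of "[]" u] by simp
  qed
  then show ?thesis
    by (auto simp: idempotents_def free_Clifford_monoid_simps) (auto simp: reduce_word_def)
qed

text \<open>No idempotent changes the word, and the single idempotent \<open>([], X)\<close> already
  equates all elements with the same word.\<close>

lemma sigma_rel_free_Clifford_monoid:
  "sigma_rel (free_Clifford_monoid X) =
    {(s, t). s \<in> carrier (free_Clifford_monoid X) \<and> t \<in> carrier (free_Clifford_monoid X) \<and> fst s = fst t}"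
  (is "?L = ?R")
proof (intro subset_antisym subsetI)
  fix st assume "st \<in> ?L"
  then show "st \<in> ?R"
    by (auto simp: sigma_rel_def idempotents_free_Clifford_monoid free_Clifford_monoid_simps
        reduce_word_reduced)
next
  fix st assume st: "st \<in> ?R"
  obtain u A v B where eq: "st = ((u, A), (v, B))" by (metis surj_pair)
  then have "(u, A) \<otimes>\<^bsub>free_Clifford_monoid X\<^esub> ([], X) = (v, B) \<otimes>\<^bsub>free_Clifford_monoid X\<^esub> ([], X)"
    using st by (auto simp: free_Clifford_monoid_simps)
  then show "st \<in> ?L"
    using st eq by (auto simp: sigma_rel_def idempotents_free_Clifford_monoid)
qed

lemma sigma_rel_image:
  assumes "(u, A) \<in> carrier (free_Clifford_monoid X)"
  shows "sigma_rel (free_Clifford_monoid X) `` {(u, A)} = sigma_class X u"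
  using assms by (auto simp: sigma_rel_free_Clifford_monoid sigma_class_def free_Clifford_monoid_simps)

lemma sigma_class_inj:
  assumes "sigma_class X u = sigma_class X v" "content u \<subseteq> X"
  shows "u = v"
proof -
  have "(u, X) \<in> sigma_class X u" using assms(2) by (simp add: sigma_class_def)
  then show ?thesis unfolding assms(1) by (simp add: sigma_class_def)
qed

lemma max_group_image_simps:
  "carrier (max_group_image (free_Clifford_monoid X)) = sigma_class X ` carrier (free_group X)"
  "\<one>\<^bsub>max_group_image (free_Clifford_monoid X)\<^esub> = sigma_class X []"
  "\<lbrakk>u \<in> carrier (free_group X); v \<in> carrier (free_group X)\<rbrakk> \<Longrightarrow>
    sigma_class X u \<otimes>\<^bsub>max_group_image (free_Clifford_monoid X)\<^esub> sigma_class X v =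
    sigma_class X (reduce_word (u @ v))"
proof -
  let ?C = "free_Clifford_monoid X"
  show "carrier (max_group_image ?C) = sigma_class X ` carrier (free_group X)"
  proof (intro subset_antisym subsetI)
    fix U assume "U \<in> carrier (max_group_image ?C)"
    then obtain u A where "(u, A) \<in> carrier ?C" "U = sigma_rel ?C `` {(u, A)}"
      by (auto simp: max_group_image_def quotient_monoid_def elim!: quotientE)
    then show "U \<in> sigma_class X ` carrier (free_group X)"
      by (auto simp: sigma_rel_image free_Clifford_monoid_simps free_group_def)
  next
    fix U assume "U \<in> sigma_class X ` carrier (free_group X)"
    then obtain u where "(u, X) \<in> carrier ?C" "U = sigma_rel ?C `` {(u, X)}"
      by (auto simp: sigma_rel_image free_Clifford_monoid_simps free_group_def)
    then show "U \<in> carrier (max_group_image ?C)"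
      by (auto simp: max_group_image_def quotient_monoid_def intro: quotientI)
  qed
  show "\<one>\<^bsub>max_group_image ?C\<^esub> = sigma_class X []"
    by (simp add: max_group_image_def quotient_monoid_def free_Clifford_monoid_simps sigma_rel_image)
  assume uv: "u \<in> carrier (free_group X)" "v \<in> carrier (free_group X)"
  have "sigma_rel ?C `` {s \<otimes>\<^bsub>?C\<^esub> t} = sigma_class X (reduce_word (u @ v))"
    if "s \<in> sigma_class X u" "t \<in> sigma_class X v" for s t
  proof -
    obtain A B where st: "s = (u, A)" "t = (v, B)" "content u \<subseteq> A" "content v \<subseteq> B" "A \<union> B \<subseteq> X"
      using \<open>s \<in> _\<close> \<open>t \<in> _\<close> by (auto simp: sigma_class_def)
    then have "(reduce_word (u @ v), A \<union> B) \<in> carrier ?C"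
      using content_reduce_word[of "u @ v"]
      by (auto simp: free_Clifford_monoid_simps reduced_word_reduce_word)
    then show ?thesis by (simp add: st free_Clifford_monoid_simps sigma_rel_image)
  qed
  \<comment> \<open>The product in \<open>quotient_monoid\<close> is a union over all
    representatives, and it collapses to the common class only if representatives exist.\<close>
  moreover have "(u, X) \<in> sigma_class X u" "(v, X) \<in> sigma_class X v"
    using uv by (auto simp: sigma_class_def free_group_def)
  ultimately show "sigma_class X u \<otimes>\<^bsub>max_group_image ?C\<^esub> sigma_class X v =
      sigma_class X (reduce_word (u @ v))"
    unfolding max_group_image_def quotient_monoid_def by auto
qed

text \<open>\<open>sigma_class X\<close> is an isomorphism from the free group with inverse
  \<open>\<pi>\<close>, and \<open>e\<close> is the unit; so \<open>mult_e\<close> says that a class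
  is the product of the letters of its reduced word.\<close>

lemma max_group_image_over_free_group:
  "monoid_over_free_group (max_group_image (free_Clifford_monoid X)) X
    (the_inv_into (carrier (free_group X)) (sigma_class X)) (\<lambda>a. sigma_class X [a]) (sigma_class X [])"
proof -
  let ?G = "max_group_image (free_Clifford_monoid X)" and ?F = "carrier (free_group X)"
  note [simp] = max_group_image_simps
  have F: "u \<in> ?F \<longleftrightarrow> reduced_word u \<and> content u \<subseteq> X" for u by (simp add: free_group_def)
  have F_mult: "reduce_word (u @ v) \<in> ?F" if "u \<in> ?F" "v \<in> ?F" for u v
    using that content_reduce_word[of "u @ v"] by (auto simp: F reduced_word_reduce_word)
  have F_single: "[a] \<in> ?F \<longleftrightarrow> fst a \<in> X" and F_Nil: "[] \<in> ?F" for a by (auto simp: F reduced_word_def)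
  have inj: "inj_on (sigma_class X) ?F"
    by (intro inj_onI sigma_class_inj) (auto simp: F)
  note inv = the_inv_into_f_f[OF inj]
  interpret monoid ?G
  proof (rule monoidI)
    fix U V assume "U \<in> carrier ?G" "V \<in> carrier ?G"
    then show "U \<otimes>\<^bsub>?G\<^esub> V \<in> carrier ?G" by (auto simp: F_mult)
    fix W assume "W \<in> carrier ?G"
    then show "U \<otimes>\<^bsub>?G\<^esub> V \<otimes>\<^bsub>?G\<^esub> W = U \<otimes>\<^bsub>?G\<^esub> (V \<otimes>\<^bsub>?G\<^esub> W)"
      using \<open>U \<in> _\<close> \<open>V \<in> _\<close> by (auto simp: F_mult reduce_word_append_assoc)
  qed (auto simp: F_Nil, auto simp: F reduce_word_reduced)
  have eval: "foldr (\<lambda>a s. sigma_class X [a] \<otimes>\<^bsub>?G\<^esub> s) u (sigma_class X []) = sigma_class X u"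
    if "u \<in> ?F" for u
    using that
  proof (induction u)
    case (Cons a u)
    then have "u \<in> ?F" "[a] \<in> ?F" by (auto simp: F reduced_word_Cons)
    with Cons show ?case using reduce_word_reduced[of "a # u"] by (simp add: F)
  qed simp
  show ?thesis
  proof
    fix U assume "U \<in> carrier ?G"
    then obtain u where "u \<in> ?F" "U = sigma_class X u" by auto
    then show "U \<otimes>\<^bsub>?G\<^esub> sigma_class X [] =
        foldr (\<lambda>a s. sigma_class X [a] \<otimes>\<^bsub>?G\<^esub> s) (the_inv_into ?F (sigma_class X) U) (sigma_class X [])"
      using F_Nil by (simp add: inv eval) (simp add: F reduce_word_reduced)
  next
    show "the_inv_into ?F (sigma_class X) \<in> hom ?G (free_group X)"
      by (auto simp: hom_def inv F_mult) (simp add: free_group_def)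
  qed (auto simp: F_single F_Nil inv, auto simp: reduce_word_def)
qed

theorem corollary2p1:
  fixes X :: "'x set"
  assumes "X \<noteq> {}"
    and "infinite (UNIV :: 'm set)"
  shows "cohomological_dimension TYPE('m) (free_Clifford_monoid X) =
           cohomological_dimension TYPE('m) (max_group_image (free_Clifford_monoid X)) \<and>
         cohomological_dimension TYPE('m) (free_Clifford_monoid X) = 1 \<and>
         cohomological_dimension TYPE('m) (max_group_image (free_Clifford_monoid X)) = 1"
  using monoid_over_free_group.cohomological_dimension_eq_1[OF free_Clifford_monoid_over_free_group assms]
    monoid_over_free_group.cohomological_dimension_eq_1[OF max_group_image_over_free_group assms]
  by simp

end
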